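(* Let $n \geq 2$ and let $D = (d_1, \ldots, d_n)$ be a nondecreasing sequence of nonnegative integers. Then there exist nonnegative integers $f$ and $g$ and a $(g,f,n)$-tournament $T$ with point matrix $(m_{ij})$ and out-degree sequence $D$ (so $g \leq m_{ij}+m_{ji} \leq f$ for all $1 \le i<j\le n$) such that every $(a,b,n)$-tournament with out-degree sequence $D$ satisfies $a \leq g$ and $b \geq f$. Moreover, $f$ and $g$ can be computed from $n$ and $D$ in $\Theta(n)$ time, and such a tournament $T$ can be constructed in $O(d_n n^2)$ time.
   Context: A loopless directed multigraph (tournament) on players $P_1,\ldots,P_n$ is given by its point matrix of nonnegative integers $m_{ij}$ with $m_{ii}=0$ ($m_{ij}$ = number of arcs from $P_i$ to $P_j$, i.e. points won by $P_i$ against $P_j$); its out-degree sequence is $(d_1,\ldots,d_n)$ with $d_i=\sum_j m_{ij}$. For nonnegative integers $a\le b$, an $(a,b,n)$-tournament is such a multigraph with $a \leq m_{ij}+m_{ji} \leq b$ for all $1\le i<j\le n$. Running times are measured in elementary arithmetic operations on integers.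
   Formalization: For the all-zero sequence (d_n = 0) the construction bound O(d_n n^2), which would literally be zero time, is read as O(n^2); that is, the bound proved is O(max(1, d_n) n^2). *)

theory Defs
  imports Complex_Main
begin

section \<open>Interval tournaments\<close>

text \<open>Players are indexed by \<open>1, \<dots>, n\<close>; values of a point matrix or of a degree sequence
  outside this range are irrelevant.\<close>

definition tournament :: "nat \<Rightarrow> nat \<Rightarrow> nat \<Rightarrow> (nat \<Rightarrow> nat \<Rightarrow> nat) \<Rightarrow> bool" where
  "tournament a b n m \<longleftrightarrow>
     a \<le> b \<and>
     (\<forall>i\<in>{1..n}. m i i = 0) \<and>
     (\<forall>i j. 1 \<le> i \<and> i < j \<and> j \<le> n \<longrightarrow> a \<le> m i j + m j i \<and> m i j + m j i \<le> b)"

definition has_out_degrees :: "nat \<Rightarrow> (nat \<Rightarrow> nat \<Rightarrow> nat) \<Rightarrow> (nat \<Rightarrow> nat) \<Rightarrow> bool" where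
  "has_out_degrees n m d \<longleftrightarrow> (\<forall>i\<in>{1..n}. (\<Sum>j=1..n. m i j) = d i)"

definition optimal_tournament ::
    "nat \<Rightarrow> (nat \<Rightarrow> nat) \<Rightarrow> nat \<Rightarrow> nat \<Rightarrow> (nat \<Rightarrow> nat \<Rightarrow> nat) \<Rightarrow> bool" where
  "optimal_tournament n d g f m \<longleftrightarrow>
     tournament g f n m \<and> has_out_degrees n m d \<and>
     (\<forall>a b m'. tournament a b n m' \<and> has_out_degrees n m' d \<longrightarrow> a \<le> g \<and> f \<le> b)"

section \<open>Programs over integers with unit-cost arithmetic\<close>

text \<open>A while language with integer variables and integer-indexed arrays. Every constant,
  memory access, arithmetic operation, comparison and logical connective that is evaluated costs
  one unit, and so does every command execution and every test of a loop. A program is a finite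
  syntactic object, so one program serves inputs of all sizes.\<close>

type_synonym vname = string

datatype aexp =
    Const int
  | Var vname
  | Arr vname aexp
  | Add aexp aexp
  | Sub aexp aexp
  | Mul aexp aexp
  | Div aexp aexp \<comment> \<open>rounds towards minus infinity; division by zero yields zero\<close>

datatype bexp =
    Less aexp aexp
  | Equal aexp aexp
  | Neg bexp
  | Conj bexp bexp

datatype com =
    Skip
  | Assign vname aexp
  | Store vname aexp aexp \<comment> \<open>array, index, new entry\<close>
  | Seq com com
  | If bexp com com
  | While bexp com

record store =
  var :: "vname \<Rightarrow> int"
  arr :: "vname \<Rightarrow> int \<Rightarrow> int"

fun aval :: "aexp \<Rightarrow> store \<Rightarrow> int" where
  "aval (Const k) s = k"
| "aval (Var x) s = var s x"
| "aval (Arr x e) s = arr s x (aval e s)"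
| "aval (Add e1 e2) s = aval e1 s + aval e2 s"
| "aval (Sub e1 e2) s = aval e1 s - aval e2 s"
| "aval (Mul e1 e2) s = aval e1 s * aval e2 s"
| "aval (Div e1 e2) s = aval e1 s div aval e2 s"

fun bval :: "bexp \<Rightarrow> store \<Rightarrow> bool" where
  "bval (Less e1 e2) s \<longleftrightarrow> aval e1 s < aval e2 s"
| "bval (Equal e1 e2) s \<longleftrightarrow> aval e1 s = aval e2 s"
| "bval (Neg b) s \<longleftrightarrow> \<not> bval b s"
| "bval (Conj b1 b2) s \<longleftrightarrow> bval b1 s \<and> bval b2 s"

fun acost :: "aexp \<Rightarrow> nat" where
  "acost (Const k) = 1"
| "acost (Var x) = 1"
| "acost (Arr x e) = 1 + acost e"
| "acost (Add e1 e2) = 1 + acost e1 + acost e2"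
| "acost (Sub e1 e2) = 1 + acost e1 + acost e2"
| "acost (Mul e1 e2) = 1 + acost e1 + acost e2"
| "acost (Div e1 e2) = 1 + acost e1 + acost e2"

fun bcost :: "bexp \<Rightarrow> nat" where
  "bcost (Less e1 e2) = 1 + acost e1 + acost e2"
| "bcost (Equal e1 e2) = 1 + acost e1 + acost e2"
| "bcost (Neg b) = 1 + bcost b"
| "bcost (Conj b1 b2) = 1 + bcost b1 + bcost b2"

text \<open>\<open>exec c s t s'\<close>: started in \<open>s\<close>, the program \<open>c\<close> halts in \<open>s'\<close> after \<open>t\<close> units of time.\<close>

inductive exec :: "com \<Rightarrow> store \<Rightarrow> nat \<Rightarrow> store \<Rightarrow> bool" where
  Skip: "exec Skip s 1 s"
| Assign: "exec (Assign x e) s (1 + acost e) (s\<lparr>var := (var s)(x := aval e s)\<rparr>)"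
| Store: "exec (Store x e1 e2) s (1 + acost e1 + acost e2)
            (s\<lparr>arr := (arr s)(x := (arr s x)(aval e1 s := aval e2 s))\<rparr>)"
| Seq: "exec c1 s1 t1 s2 \<Longrightarrow> exec c2 s2 t2 s3 \<Longrightarrow> exec (Seq c1 c2) s1 (t1 + t2) s3"
| IfTrue: "bval b s \<Longrightarrow> exec c1 s t s' \<Longrightarrow> exec (If b c1 c2) s (1 + bcost b + t) s'"
| IfFalse: "\<not> bval b s \<Longrightarrow> exec c2 s t s' \<Longrightarrow> exec (If b c1 c2) s (1 + bcost b + t) s'"
| WhileFalse: "\<not> bval b s \<Longrightarrow> exec (While b c) s (1 + bcost b) s"
| WhileTrue: "bval b s1 \<Longrightarrow> exec c s1 t1 s2 \<Longrightarrow> exec (While b c) s2 t2 s3 \<Longrightarrow>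
                exec (While b c) s1 (1 + bcost b + t1 + t2) s3"

inductive_cases exec_elims:
  "exec Skip s t s'" "exec (Assign x e) s t s'" "exec (Store x e1 e2) s t s'"
  "exec (Seq c1 c2) s t s'" "exec (If b c1 c2) s t s'"

inductive_cases exec_WhileE: "exec (While b c) s t s'"

text \<open>Since execution is deterministic, exhibiting one terminating run determines the outcome
  and the running time.\<close>

lemma exec_deterministic:
  "exec c s t s' \<Longrightarrow> exec c s u s'' \<Longrightarrow> u = t \<and> s'' = s'"
proof (induction arbitrary: u s'' rule: exec.induct)
  case (Skip s)
  then show ?case by (rule exec_elims(1)) simp
next
  case (Assign x e s)
  then show ?case by (rule exec_elims(2)) simp
next
  case (Store x e1 e2 s)
  then show ?case by (rule exec_elims(3)) simp
next
  case (Seq c1 s1 t1 s2 c2 t2 s3)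
  from Seq.prems show ?case
    by (rule exec_elims(4)) (auto dest!: Seq.IH)
next
  case (IfTrue b s c1 t s' c2)
  from IfTrue.prems show ?case
    by (rule exec_elims(5)) (use IfTrue.hyps(1) in \<open>auto dest!: IfTrue.IH\<close>)
next
  case (IfFalse b s c2 t s' c1)
  from IfFalse.prems show ?case
    by (rule exec_elims(5)) (use IfFalse.hyps(1) in \<open>auto dest!: IfFalse.IH\<close>)
next
  case (WhileFalse b s c)
  from WhileFalse.prems show ?case
    by (rule exec_WhileE) (use WhileFalse.hyps in simp_all)
next
  case (WhileTrue b s1 c t1 s2 t2 s3)
  from WhileTrue.prems show ?case
    by (rule exec_WhileE) (use WhileTrue.hyps(1) in \<open>auto dest!: WhileTrue.IH\<close>)
qed

text \<open>The input consists of \<open>n\<close> and the array \<open>d 1, \<dots>, d n\<close>; all other memory is zero.\<close>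

definition input :: "nat \<Rightarrow> (nat \<Rightarrow> nat) \<Rightarrow> store" where
  "input n d =
     \<lparr>var = (\<lambda>x. if x = ''n'' then int n else 0),
      arr = (\<lambda>x k. if x = ''d'' \<and> 1 \<le> k \<and> k \<le> int n then int (d (nat k)) else 0)\<rparr>"

definition outputs_bounds :: "store \<Rightarrow> nat \<Rightarrow> nat \<Rightarrow> bool" where
  "outputs_bounds s g f \<longleftrightarrow> var s ''g'' = int g \<and> var s ''f'' = int f"

text \<open>The matrix is read off in row-major order from the cells \<open>1, \<dots>, n\<^sup>2\<close> of the array \<open>m\<close>.\<close>

definition outputs_matrix :: "store \<Rightarrow> nat \<Rightarrow> (nat \<Rightarrow> nat \<Rightarrow> nat) \<Rightarrow> bool" where
  "outputs_matrix s n m \<longleftrightarrow>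
     (\<forall>i\<in>{1..n}. \<forall>j\<in>{1..n}. arr s ''m'' (int ((i - 1) * n + j)) = int (m i j))"

end

(* Counting arcs inside the k smallest scores, and arcs meeting the n - k largest, gives the
   necessary conditions lower_ok on a and upper_ok on b. These are independent of each other, and
   the extreme values g and f can be attained together: start from the transitive tournament in
   which higher indices win every arc, with g arcs on each pair and the surplus of the score sum
   packed, up to f arcs per pair, onto the highest rows. The two conditions say exactly that its
   score sequence majorizes D. A point can be moved from a player to any player of smaller score
   by changing at most two pairs, so D is reached by at most sum D <= n * d_n transfers, each found
   by a linear search. *)

theory Submission
  imports Defs
begin

section \<open>Weakest preconditions with running times\<close>

text \<open>The prefix sums show why \<open>g\<close> and \<open>f\<close> are attained together.
  The first \<open>k\<close> scores of the initial tournament sum to \<open>g * (k choose 2)\<close>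
  plus the surplus still unspent on reaching row \<open>k\<close>. That remainder is a truncated
  difference: where it is zero, comparison with D is the lower condition for \<open>g\<close>; where
  it is positive, it is the upper condition for \<open>f\<close>. Packing the surplus at the top
  keeps all prefix sums small at once. The repair settles rows in increasing order because a
  transfer needs a donor whose score exceeds the receiver's. If row \<open>i\<close> has an excess
  while no smaller row has one, the prefix inequality yields some \<open>j < i\<close> in deficit,
  and monotonicity of D gives score of \<open>j\<close> < \<open>d j\<close> <= \<open>d i\<close> <
  score of \<open>i\<close>. Such a transfer changes neither the sum of the first \<open>i\<close>
  scores nor any score beyond \<open>i\<close>, so the prefix inequalities of the initial tournament
  stay available for later rows. As no transfer creates an excess, the number of transfers is the
  total initial excess, which is at most the sum of D.\<close>

definition wp :: "com \<Rightarrow> (nat \<Rightarrow> store \<Rightarrow> bool) \<Rightarrow> store \<Rightarrow> bool" where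
  "wp c Q s \<longleftrightarrow> (\<exists>t s'. exec c s t s' \<and> Q t s')"

lemma wp_mono: "wp c Q s \<Longrightarrow> (\<And>t s'. Q t s' \<Longrightarrow> R t s') \<Longrightarrow> wp c R s"
  unfolding wp_def by blast

text \<open>Determinism turns the existential into an equivalence, so the rules for loop-free
  commands can be simplification rules that compute the exact running time.\<close>

lemma wp_exec: "exec c s t s' \<Longrightarrow> wp c Q s \<longleftrightarrow> Q t s'"
  unfolding wp_def using exec_deterministic by blast

lemma wp_Skip [simp]: "wp Skip Q s \<longleftrightarrow> Q 1 s"
  by (rule wp_exec[OF exec.Skip])

lemma wp_Assign [simp]:
  "wp (Assign x e) Q s \<longleftrightarrow> Q (1 + acost e) (s\<lparr>var := (var s)(x := aval e s)\<rparr>)"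
  by (rule wp_exec[OF exec.Assign])

lemma wp_Store [simp]:
  "wp (Store x e1 e2) Q s \<longleftrightarrow>
     Q (1 + acost e1 + acost e2) (s\<lparr>arr := (arr s)(x := (arr s x)(aval e1 s := aval e2 s))\<rparr>)"
  by (rule wp_exec[OF exec.Store])

lemma wp_Seq [simp]:
  "wp (Seq c1 c2) Q s \<longleftrightarrow> wp c1 (\<lambda>t1. wp c2 (\<lambda>t2. Q (t1 + t2))) s"
  unfolding wp_def by (blast intro: exec.intros elim: exec_elims)

lemma wp_If [simp]:
  "wp (If b c1 c2) Q s \<longleftrightarrow> wp (if bval b s then c1 else c2) (\<lambda>t. Q (1 + bcost b + t)) s"
  unfolding wp_def
  by (cases "bval b s")
    (auto intro: exec.IfTrue[simplified] exec.IfFalse[simplified] elim!: exec_elims(5))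

text \<open>The iteration count \<open>N\<close> need not be known to the program.\<close>

lemma wp_While:
  assumes "I 0 s"
    and step: "\<And>i s. i < N \<Longrightarrow> I i s \<Longrightarrow>
      bval b s \<and> wp c (\<lambda>t s'. t \<le> u i \<and> I (Suc i) s') s"
    and stop: "\<And>s. I N s \<Longrightarrow> \<not> bval b s"
    and post: "\<And>t s'. N \<le> t \<Longrightarrow> t \<le> (\<Sum>i<N. u i + 1 + bcost b) + 1 + bcost b \<Longrightarrow>
      I N s' \<Longrightarrow> Q t s'"
  shows "wp (While b c) Q s"
proof -
  \<comment> \<open>Generalised to a run resumed after \<open>k\<close> iterations, for backward
    induction from \<open>N\<close>. The bound \<open>N - k <= t\<close> is carried along because it
    later yields the linear lower bound on the time.\<close>
  have "\<exists>t s'. exec (While b c) s t s' \<and> N - k \<le> t \<and>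
      t \<le> (\<Sum>i=k..<N. u i + 1 + bcost b) + 1 + bcost b \<and> I N s'"
    if "k \<le> N" "I k s" for k s
    using that
  proof (induction k arbitrary: s rule: inc_induct)
    case base
    then show ?case using exec.WhileFalse[OF stop] by fastforce
  next
    case (step k)
    from assms(2)[OF step.hyps(2) step.prems] obtain t s' where 1:
      "bval b s" "exec c s t s'" "t \<le> u k" "I (Suc k) s'"
      unfolding wp_def by blast
    from step.IH[OF 1(4)] obtain t' s'' where 2:
      "exec (While b c) s' t' s''" "N - Suc k \<le> t'"
      "t' \<le> (\<Sum>i=Suc k..<N. u i + 1 + bcost b) + 1 + bcost b" "I N s''"
      by blast
    have "exec (While b c) s (1 + bcost b + t + t') s''"
      using 1 2 by (intro exec.WhileTrue)
    moreover have "(\<Sum>i=k..<N. u i + 1 + bcost b) =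
        u k + 1 + bcost b + (\<Sum>i=Suc k..<N. u i + 1 + bcost b)"
      using step.hyps by (simp add: sum.atLeast_Suc_lessThan)
    ultimately show ?case using 1 2
      by (intro exI[of _ "1 + bcost b + t + t'"] exI[of _ s'']) auto
  qed
  from this[of 0 s] assms(1) obtain t s' where
    "exec (While b c) s t s'" "N \<le> t" "t \<le> (\<Sum>i<N. u i + 1 + bcost b) + 1 + bcost b" "I N s'"
    by (auto simp: atLeast0LessThan)
  with post show ?thesis unfolding wp_def by blast
qed

section \<open>Counting bounds\<close>

lemma choose2_Suc: "Suc k choose 2 = (k choose 2) + k"
  by (simp add: numeral_2_eq_2)

text \<open>Landau's inequalities for score sequences, scaled by the number \<open>a\<close> of arcs
  per pair. Prefixes suffice, since for nondecreasing \<open>d\<close> they are the sets of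
  \<open>k\<close> players with least total score.\<close>

definition lower_ok :: "nat \<Rightarrow> (nat \<Rightarrow> nat) \<Rightarrow> nat \<Rightarrow> bool" where
  "lower_ok n d a \<longleftrightarrow> (\<forall>k\<le>n. a * (k choose 2) \<le> (\<Sum>i=1..k. d i))"

text \<open>The \<open>n - k\<close> largest scores sum to at most \<open>b\<close> times the number
  \<open>n choose 2 - k choose 2\<close> of pairs meeting these players; stated so that no subtraction occurs.\<close>

definition upper_ok :: "nat \<Rightarrow> (nat \<Rightarrow> nat) \<Rightarrow> nat \<Rightarrow> bool" where
  "upper_ok n d b \<longleftrightarrow> (\<forall>k\<le>n. (\<Sum>i=1..n. d i) + b * (k choose 2) \<le> (\<Sum>i=1..k. d i) + b * (n choose 2))"

lemma tournament_pair_le: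
  "tournament a b n m \<Longrightarrow> 1 \<le> i \<Longrightarrow> i \<le> n \<Longrightarrow> 1 \<le> j \<Longrightarrow> j \<le> n \<Longrightarrow> i \<noteq> j \<Longrightarrow>
    a \<le> m i j + m j i \<and> m i j + m j i \<le> b"
  unfolding tournament_def
  by (cases i j rule: linorder_cases) (simp_all, simp add: add.commute[of "m i j"])

text \<open>Allows both counting bounds to be proved by adding or removing one player: player
  \<open>Suc k\<close> forms exactly one pair with each of the first \<open>k\<close>.\<close>

lemma sum_square_Suc:
  fixes m :: "nat \<Rightarrow> nat \<Rightarrow> nat"
  assumes "m (Suc k) (Suc k) = 0"
  shows "(\<Sum>i=1..Suc k. \<Sum>j=1..Suc k. m i j) =
    (\<Sum>i=1..k. \<Sum>j=1..k. m i j) + (\<Sum>i=1..k. m i (Suc k) + m (Suc k) i)"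
  using assms by (simp add: sum.distrib algebra_simps)

lemma tournament_lower_ok:
  assumes "tournament a b n m" "has_out_degrees n m d"
  shows "lower_ok n d a"
proof -
  have sq: "a * (k choose 2) \<le> (\<Sum>i=1..k. \<Sum>j=1..k. m i j)" if "k \<le> n" for k
    using that
  proof (induction k)
    case (Suc k)
    have "(\<Sum>i=1..k. a) \<le> (\<Sum>i=1..k. m i (Suc k) + m (Suc k) i)"
      using Suc.prems tournament_pair_le[OF assms(1)] by (intro sum_mono) auto
    moreover have "m (Suc k) (Suc k) = 0"
      using assms(1) Suc.prems by (simp add: tournament_def)
    ultimately show ?case
      unfolding sum_square_Suc[of m k, OF \<open>m (Suc k) (Suc k) = 0\<close>] choose2_Suc
      using Suc by (simp add: algebra_simps)
  qed simp
  show ?thesis unfolding lower_ok_def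
  proof (intro allI impI)
    fix k assume k: "k \<le> n"
    have "(\<Sum>i=1..k. \<Sum>j=1..k. m i j) \<le> (\<Sum>i=1..k. \<Sum>j=1..n. m i j)"
      using k by (intro sum_mono sum_mono2) auto
    also have "\<dots> = (\<Sum>i=1..k. d i)"
      using assms(2) k by (intro sum.cong) (auto simp: has_out_degrees_def)
    finally show "a * (k choose 2) \<le> (\<Sum>i=1..k. d i)" using sq[OF k] by simp
  qed
qed

lemma tournament_upper_ok:
  assumes "tournament a b n m" "has_out_degrees n m d"
  shows "upper_ok n d b"
proof -
  have sq: "(\<Sum>i=1..n. \<Sum>j=1..n. m i j) + b * (k choose 2) \<le>
      (\<Sum>i=1..k. \<Sum>j=1..k. m i j) + b * (n choose 2)" if "k \<le> n" for k
    using that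
  \<comment> \<open>Downwards from \<open>k = n\<close>, where both sides agree: deleting player
    \<open>Suc k\<close> removes \<open>k\<close> pairs with at most \<open>b\<close> arcs
    each.\<close>
  proof (induction k rule: inc_induct)
    case (step k)
    have "(\<Sum>i=1..k. m i (Suc k) + m (Suc k) i) \<le> (\<Sum>i=1..k. b)"
      using step.hyps tournament_pair_le[OF assms(1)] by (intro sum_mono) auto
    moreover have "m (Suc k) (Suc k) = 0"
      using assms(1) step.hyps by (simp add: tournament_def)
    ultimately show ?case
      using step.IH
      unfolding sum_square_Suc[of m k, OF \<open>m (Suc k) (Suc k) = 0\<close>] choose2_Suc
      by (simp add: algebra_simps)
  qed simp
  have eq: "(\<Sum>i=1..k. \<Sum>j=1..n. m i j) = (\<Sum>i=1..k. d i)" if "k \<le> n" for k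
    using assms(2) that by (intro sum.cong) (auto simp: has_out_degrees_def)
  show ?thesis unfolding upper_ok_def
  proof (intro allI impI)
    fix k assume k: "k \<le> n"
    have "(\<Sum>i=1..k. \<Sum>j=1..k. m i j) \<le> (\<Sum>i=1..k. \<Sum>j=1..n. m i j)"
      using k by (intro sum_mono sum_mono2) auto
    with sq[OF k] eq[OF k] eq[of n]
    show "(\<Sum>i=1..n. d i) + b * (k choose 2) \<le> (\<Sum>i=1..k. d i) + b * (n choose 2)" by simp
  qed
qed

section \<open>Computing the bounds\<close>

abbreviation seq (infixr ";;" 60) where
  "c1 ;; c2 \<equiv> Seq c1 c2"

abbreviation assign (infix "::=" 61) where
  "x ::= e \<equiv> Assign x e"

text \<open>The upward loop takes the minimum of the floors of prefix sum by pairs inside the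
  prefix. It starts at \<open>k = 2\<close> because smaller prefixes contain no pair, hence give no
  condition and a zero divisor. The downward loop reuses \<open>k = n\<close> and takes the maximum
  of the ceilings of suffix sum \<open>T\<close> by the number \<open>e\<close> of pairs meeting the
  suffix.\<close>

definition bounds_prog :: com where
  "bounds_prog =
    ''S'' ::= Add (Arr ''d'' (Const 1)) (Arr ''d'' (Const 2)) ;;
    ''c'' ::= Const 1 ;;
    ''g'' ::= Var ''S'' ;;
    ''k'' ::= Const 2 ;;
    While (Less (Var ''k'') (Var ''n''))
      (''c'' ::= Add (Var ''c'') (Var ''k'') ;;
       ''k'' ::= Add (Var ''k'') (Const 1) ;;
       ''S'' ::= Add (Var ''S'') (Arr ''d'' (Var ''k'')) ;;
       ''q'' ::= Div (Var ''S'') (Var ''c'') ;;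
       If (Less (Var ''q'') (Var ''g'')) (''g'' ::= Var ''q'') Skip) ;;
    ''T'' ::= Const 0 ;;
    ''e'' ::= Const 0 ;;
    ''f'' ::= Const 0 ;;
    While (Less (Const 0) (Var ''k''))
      (''T'' ::= Add (Var ''T'') (Arr ''d'' (Var ''k'')) ;;
       ''k'' ::= Sub (Var ''k'') (Const 1) ;;
       ''e'' ::= Add (Var ''e'') (Var ''k'') ;;
       ''q'' ::= Div (Sub (Add (Var ''T'') (Var ''e'')) (Const 1)) (Var ''e'') ;;
       If (Less (Var ''f'') (Var ''q'')) (''f'' ::= Var ''q'') Skip)"

text \<open>The quotient is the ceiling of \<open>t / c\<close>; the equivalence is its Galois
  connection with multiplication by \<open>c\<close>.\<close>

lemma ceil_div_le_iff: "0 < c \<Longrightarrow> (t + c - 1) div c \<le> b \<longleftrightarrow> t \<le> b * c" for t c b :: nat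
proof -
  assume c: "0 < c"
  have "(t + c - 1) div c \<le> b \<longleftrightarrow> (t + c - 1) div c < Suc b" by auto
  also have "\<dots> \<longleftrightarrow> t + c - 1 < Suc b * c"
    using c by (simp add: div_less_iff_less_mult)
  also have "\<dots> \<longleftrightarrow> t \<le> b * c" using c by auto
  finally show ?thesis .
qed

section \<open>Extending the counting conditions by one index\<close>

lemma choose2_pos: "2 \<le> k \<Longrightarrow> 0 < k choose 2"
  by simp

text \<open>One more index adds one inequality, which cuts the admissible initial segment of values
  \<open>a\<close> at a floor; \<open>2 <= Suc k\<close> makes the divisor positive.\<close>

lemma lower_ok_step:
  assumes "2 \<le> Suc k" "\<forall>a. lower_ok k d a \<longleftrightarrow> a \<le> g"
  shows "lower_ok (Suc k) d a \<longleftrightarrow> a \<le> min g ((\<Sum>i=1..Suc k. d i) div (Suc k choose 2))"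
proof -
  have "lower_ok (Suc k) d a \<longleftrightarrow> lower_ok k d a \<and> a * (Suc k choose 2) \<le> (\<Sum>i=1..Suc k. d i)"
    unfolding lower_ok_def using le_Suc_eq by auto
  with assms show ?thesis
    using less_eq_div_iff_mult_less_eq[OF choose2_pos[OF assms(1)]] by auto
qed

text \<open>Suffix form of the upper conditions, restricted to indices from \<open>k\<close> on so
  that a downward loop can build them up. Player \<open>Suc i\<close> has \<open>i\<close> smaller
  opponents, so the sum of \<open>i\<close> over \<open>{l..<n}\<close> counts the pairs meeting a
  player beyond \<open>l\<close>. The trivial index \<open>l = n\<close>, with no such pair, is left
  out.\<close>

definition upper_ok_from :: "nat \<Rightarrow> nat \<Rightarrow> (nat \<Rightarrow> nat) \<Rightarrow> nat \<Rightarrow> bool" where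
  "upper_ok_from k n d b \<longleftrightarrow> (\<forall>l\<in>{k..<n}. (\<Sum>i=Suc l..n. d i) \<le> b * (\<Sum>i=l..<n. i))"

lemma choose2_split: "k \<le> n \<Longrightarrow> n choose 2 = (k choose 2) + (\<Sum>i=k..<n. i)"
  by (induction n rule: dec_induct) (auto simp: choose2_Suc)

lemma choose2_mono: "k \<le> n \<Longrightarrow> k choose 2 \<le> n choose 2"
  using choose2_split[of k n] by simp

lemma upper_ok_iff: "upper_ok n d b \<longleftrightarrow> upper_ok_from 0 n d b"
proof -
  have "(\<Sum>i=1..n. d i) + b * (k choose 2) \<le> (\<Sum>i=1..k. d i) + b * (n choose 2) \<longleftrightarrow>
      (\<Sum>i=Suc k..n. d i) \<le> b * (\<Sum>i=k..<n. i)" if "k \<le> n" for k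
  proof -
    have "(\<Sum>i=1..n. d i) = (\<Sum>i=1..k. d i) + (\<Sum>i=Suc k..n. d i)"
      using that sum.ub_add_nat[of 1 k d "n - k"] by simp
    then show ?thesis by (simp add: choose2_split[OF that] distrib_left)
  qed
  then show ?thesis unfolding upper_ok_def upper_ok_from_def
    by (auto simp: le_less)
qed

lemma upper_ok_from_step:
  assumes "Suc k \<le> n" "2 \<le> n" "\<forall>b. upper_ok_from (Suc k) n d b \<longleftrightarrow> f \<le> b"
  defines "c \<equiv> \<Sum>i=k..<n. i"
  shows "upper_ok_from k n d b \<longleftrightarrow> max f (((\<Sum>i=Suc k..n. d i) + c - 1) div c) \<le> b"
proof -
  \<comment> \<open>The divisor \<open>c\<close> is positive because it contains the summand
    \<open>n - 1 >= 1\<close>.\<close>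
  have "{n - 1} \<subseteq> {k..<n}" using assms by auto
  then have "(\<Sum>i\<in>{n - 1}. i) \<le> c" unfolding c_def by (intro sum_mono2) auto
  then have "0 < c" using assms(2) by simp
  have "{k..<n} = insert k {Suc k..<n}" using assms by auto
  then have "upper_ok_from k n d b \<longleftrightarrow>
      upper_ok_from (Suc k) n d b \<and> (\<Sum>i=Suc k..n. d i) \<le> b * c"
    unfolding upper_ok_from_def c_def by auto
  with ceil_div_le_iff[OF \<open>0 < c\<close>] assms(3) show ?thesis by simp
qed

text \<open>The outputs are characterised as thresholds of the counting conditions, which makes
  sense before any tournament is known to attain them. \<open>S\<close> and \<open>c\<close> are
  recorded because the construction of the matrix continues from them.\<close>

lemma wp_bounds_prog:
  assumes n: "2 \<le> n" "var s ''n'' = int n"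
    and d: "\<And>k. 1 \<le> k \<Longrightarrow> k \<le> n \<Longrightarrow> arr s ''d'' (int k) = int (d k)"
  shows "wp bounds_prog (\<lambda>t s'. n \<le> t \<and> t \<le> 100 * n \<and> arr s' = arr s \<and>
      var s' ''n'' = int n \<and> var s' ''S'' = int (\<Sum>i=1..n. d i) \<and>
      var s' ''c'' = int (n choose 2) \<and>
      (\<exists>g f. outputs_bounds s' g f \<and> (\<forall>a. lower_ok n d a \<longleftrightarrow> a \<le> g) \<and>
         (\<forall>b. upper_ok n d b \<longleftrightarrow> f \<le> b))) s"
proof -
  let ?I = "\<lambda>i s'. arr s' = arr s \<and> var s' ''n'' = int n \<and> var s' ''k'' = int (i + 2) \<and>
    var s' ''S'' = int (\<Sum>j=1..i + 2. d j) \<and> var s' ''c'' = int (i + 2 choose 2) \<and>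
    (\<exists>g. var s' ''g'' = int g \<and> (\<forall>a. lower_ok (i + 2) d a \<longleftrightarrow> a \<le> g))"
  let ?J = "\<lambda>g i s'. arr s' = arr s \<and> var s' ''n'' = int n \<and> var s' ''k'' = int (n - i) \<and>
    var s' ''S'' = int (\<Sum>j=1..n. d j) \<and> var s' ''c'' = int (n choose 2) \<and>
    var s' ''g'' = int g \<and> var s' ''T'' = int (\<Sum>j=Suc (n - i)..n. d j) \<and>
    var s' ''e'' = int (\<Sum>j=n - i..<n. j) \<and>
    (\<exists>f. var s' ''f'' = int f \<and> (\<forall>b. upper_ok_from (n - i) n d b \<longleftrightarrow> f \<le> b))"
  \<comment> \<open>Start of the upward loop: two players form a single pair, so the threshold is
    the total score, which is the initial value of \<open>g\<close>.\<close>
  have low2: "lower_ok (Suc (Suc 0)) d a \<longleftrightarrow> a \<le> d (Suc 0) + d (Suc (Suc 0))" for a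
    by (auto simp: lower_ok_def le_Suc_eq numeral_2_eq_2)
  have n2: "n - 2 + 2 = n" using n by simp
  have d12: "arr s ''d'' 1 = int (d (Suc 0))" "arr s ''d'' 2 = int (d (Suc (Suc 0)))"
    using d[of 1] d[of 2] n by (simp_all add: numeral_2_eq_2)
  show ?thesis
    unfolding bounds_prog_def
    apply (simp add: One_nat_def[symmetric] del: One_nat_def)
    apply (rule wp_While[where I="?I" and N="n - 2" and u="\<lambda>_. 26"])
    subgoal using low2 d12 n
      by (simp add: numeral_2_eq_2) (rule exI[of _ "d (Suc 0) + d (Suc (Suc 0))"], simp)
    subgoal for i s'
    proof -
      assume i: "i < n - 2" and I: "?I i s'"
      define S c where "S = (\<Sum>j=1..i + 2. d j)" and "c = (i + 2 choose 2)"
      obtain g where g: "var s' ''g'' = int g" "\<forall>a. lower_ok (i + 2) d a \<longleftrightarrow> a \<le> g"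
        using I by blast
      have S': "(\<Sum>j=1..Suc i + 2. d j) = S + d (i + 3)" unfolding S_def by (simp add: numeral_3_eq_3)
      have c': "(Suc i + 2 choose 2) = c + (i + 2)" unfolding c_def using choose2_Suc[of "i + 2"] by simp
      have low: "lower_ok (Suc i + 2) d a \<longleftrightarrow> a \<le> min g ((S + d (i + 3)) div (c + (i + 2)))" for a
        using lower_ok_step[of "i + 2" d g a] g(2) S' c' by simp
      have di: "arr s ''d'' (int i + 3) = int (d (i + 3))"
        using d[of "i + 3"] i by (simp add: algebra_simps)
      have q: "(int S + int (d (i + 3))) div (int c + (int i + 2)) = int ((S + d (i + 3)) div (c + (i + 2)))"
        by (simp add: zdiv_int algebra_simps)
      have I': "arr s' = arr s" "var s' ''n'' = int n" "var s' ''k'' = int i + 2"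
        "var s' ''S'' = int S" "var s' ''c'' = int c"
        using I by (simp_all add: S_def c_def)
      show ?thesis
        unfolding S' c' low using i
        by (auto simp: I' g(1) di q add.assoc simp del: of_nat_div
            intro!: exI[of _ "min g ((S + d (i + 3)) div (c + (i + 2)))"])
    qed
    subgoal using n by simp
    subgoal for t s'
      apply (simp only: n2)
      apply simp
      \<comment> \<open>The first invariant gives \<open>g\<close> only existentially, so it is
        recovered from its register by \<open>nat\<close>. This loop runs exactly \<open>n\<close>
        times, which by itself gives the lower bound \<open>n <= t\<close>.\<close>
      apply (rule wp_While[where I="?J (nat (var s' ''g''))" and N="n" and u="\<lambda>_. 28"])
      \<comment> \<open>At \<open>k = n\<close> the index set is empty, so the threshold starts at
        0.\<close>
      subgoal using n by (auto simp: upper_ok_from_def)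
      subgoal for i s''
      proof -
        assume i: "i < n" and J: "?J (nat (var s' ''g'')) i s''"
        define k where "k = n - Suc i"
        have k: "n - i = Suc k" "n - Suc i = k" "Suc k \<le> n" unfolding k_def using i by auto
        define T e where "T = (\<Sum>j=Suc (Suc k)..n. d j)" and "e = (\<Sum>j=Suc k..<n. j)"
        obtain f where f: "var s'' ''f'' = int f" "\<forall>b. upper_ok_from (Suc k) n d b \<longleftrightarrow> f \<le> b"
          using J k by auto
        have T': "(\<Sum>j=Suc k..n. d j) = T + d (Suc k)"
          unfolding T_def using sum.atLeast_Suc_atMost[OF k(3), of d] by simp
        have e': "(\<Sum>j=k..<n. j) = e + k"
          unfolding e_def using k(3) by (simp add: sum.atLeast_Suc_lessThan)
        define q where "q = (T + d (Suc k) + (e + k) - 1) div (e + k)"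
        have up: "upper_ok_from k n d b \<longleftrightarrow> max f q \<le> b" for b
          using upper_ok_from_step[OF k(3) n(1) f(2)] unfolding T' e' q_def .
        \<comment> \<open>Needed so that the truncated \<open>- 1\<close> in \<open>q\<close> agrees
          with the integer subtraction of the program.\<close>
        have "0 < e + k"
        proof -
          have "{n - 1} \<subseteq> {k..<n}" using n k by auto
          then have "(\<Sum>i\<in>{n - 1}. i) \<le> e + k" unfolding e'[symmetric] by (intro sum_mono2) auto
          then have "n - 1 \<le> e + k" by simp
          then show ?thesis using n(1) by linarith
        qed
        then have q: "(int T + (int (d (Suc k)) + (int e + int k)) - 1) div (int e + int k) = int q"
        proof -
          have "int (T + d (Suc k) + (e + k) - 1) = int T + int (d (Suc k)) + (int e + int k) - 1"
            using \<open>0 < e + k\<close> by linarith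
          then show ?thesis unfolding q_def zdiv_int by (simp add: add.assoc)
        qed
        have dk: "arr s ''d'' (1 + int k) = int (d (Suc k))"
          using d[of "Suc k"] k by simp
        have J': "arr s'' = arr s" "var s'' ''n'' = int n" "var s'' ''k'' = 1 + int k"
          "var s'' ''S'' = int (\<Sum>j=1..n. d j)" "var s'' ''c'' = int (n choose 2)"
          "var s'' ''g'' = int (nat (var s' ''g''))" "var s'' ''T'' = int T" "var s'' ''e'' = int e"
          using J by (simp_all add: k T_def e_def)
        show ?thesis
          unfolding k T' e' up
          by (auto simp: J' f(1) dk q add.assoc intro!: exI[of _ "max f q"])
      qed
      subgoal using n by simp
      subgoal using n by (auto simp: outputs_bounds_def upper_ok_iff)
      done
    done
qed

section \<open>Point matrices in memory\<close>

definition score :: "nat \<Rightarrow> (nat \<Rightarrow> nat \<Rightarrow> nat) \<Rightarrow> nat \<Rightarrow> nat" where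
  "score n m i = (\<Sum>j=1..n. m i j)"

definition set_entry :: "nat \<Rightarrow> nat \<Rightarrow> nat \<Rightarrow> (nat \<Rightarrow> nat \<Rightarrow> nat) \<Rightarrow> nat \<Rightarrow> nat \<Rightarrow> nat" where
  "set_entry i j v m = m(i := (m i)(j := v))"

text \<open>The change \<open>v - m i j\<close> may be negative; the old entry is added on the left
  so that no natural subtraction occurs.\<close>

lemma score_set_entry:
  assumes "1 \<le> j" "j \<le> n"
  shows "score n (set_entry i j v m) a + (if a = i then m i j else 0) =
    score n m a + (if a = i then v else 0)"
proof -
  have "(\<Sum>l\<in>{1..n}. (set_entry i j v m) a l) =
      (set_entry i j v m) a j + (\<Sum>l\<in>{1..n} - {j}. (set_entry i j v m) a l)"
    using assms by (intro sum.remove) auto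
  moreover have "(\<Sum>l\<in>{1..n} - {j}. (set_entry i j v m) a l) = (\<Sum>l\<in>{1..n} - {j}. m a l)"
    by (intro sum.cong) (auto simp: set_entry_def)
  moreover have "(\<Sum>l\<in>{1..n}. m a l) = m a j + (\<Sum>l\<in>{1..n} - {j}. m a l)"
    using assms by (intro sum.remove) auto
  ultimately show ?thesis by (auto simp: score_def set_entry_def)
qed

text \<open>The array \<open>r\<close> holds the row sums of the matrix stored in \<open>m\<close>.\<close>

definition represents :: "nat \<Rightarrow> store \<Rightarrow> (nat \<Rightarrow> nat \<Rightarrow> nat) \<Rightarrow> bool" where
  "represents n s m \<longleftrightarrow> var s ''n'' = int n \<and>
     (\<forall>i j. 1 \<le> i \<and> i \<le> n \<and> 1 \<le> j \<and> j \<le> n \<longrightarrow>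
        arr s ''m'' ((int i - 1) * int n + int j) = int (m i j)) \<and>
     (\<forall>i. 1 \<le> i \<and> i \<le> n \<longrightarrow> arr s ''r'' (int i) = int (score n m i))"

text \<open>Cells in the same column of different rows lie at least \<open>n\<close> apart, while
  columns differ by less than \<open>n\<close>.\<close>

lemma cell_inject:
  assumes "1 \<le> j" "j \<le> n" "1 \<le> j'" "j' \<le> n"
  shows "(int i - 1) * int n + int j = (int i' - 1) * int n + int j' \<longleftrightarrow> i = i' \<and> j = j'"
proof -
  have False if "i < i'" "(int i - 1) * int n + int j = (int i' - 1) * int n + int j'"
    "1 \<le> j'" "j \<le> n" for i i' j j'
  proof -
    have "int n * 1 \<le> int n * (int i' - int i)"
      using that(1) by (intro mult_left_mono) auto
    with that(2-) show False by (simp add: algebra_simps)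
  qed
  with assms show ?thesis by (cases i i' rule: linorder_cases) (force, simp, metis)
qed

definition cell :: "vname \<Rightarrow> vname \<Rightarrow> aexp" where
  "cell x y = Add (Mul (Sub (Var x) (Const 1)) (Var ''n'')) (Var y)"

lemma aval_cell [simp]: "aval (cell x y) s = (var s x - 1) * var s ''n'' + var s y"
  by (simp add: cell_def)

lemma acost_cell [simp]: "acost (cell x y) = 7"
  by (simp add: cell_def)

text \<open>The row sum is updated together with the entry, so that a score can later be compared
  with its target in constant time.\<close>

definition incr :: "vname \<Rightarrow> vname \<Rightarrow> aexp \<Rightarrow> com" where
  "incr x y e =
    Store ''m'' (cell x y) (Add (Arr ''m'' (cell x y)) e) ;;
    Store ''r'' (Var x) (Add (Arr ''r'' (Var x)) e)"

text \<open>The effect is described by the new entry \<open>w\<close>, which covers increments and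
  decrements alike. The expression \<open>e\<close> is evaluated twice, the second time after
  \<open>m\<close> has changed, so its value is required to be independent of the arrays.\<close>

lemma wp_incr:
  assumes rep: "represents n s m" and x: "var s x = int i" and y: "var s y = int j"
    and ij: "1 \<le> i" "i \<le> n" "1 \<le> j" "j \<le> n"
    and e: "\<And>A. aval e (s\<lparr>arr := A\<rparr>) = int w - int (m i j)"
    and Q: "\<And>s'. represents n s' (set_entry i j w m) \<Longrightarrow> var s' = var s \<Longrightarrow>
      arr s' ''d'' = arr s ''d'' \<Longrightarrow> Q (22 + 2 * acost e) s'"
  shows "wp (incr x y e) Q s"
proof -
  define v where "v = int w - int (m i j)"
  define A where "A = (arr s)(''m'' := (arr s ''m'')((int i - 1) * int n + int j := int w),
    ''r'' := (arr s ''r'')(int i := arr s ''r'' (int i) + v))"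
  have n: "var s ''n'' = int n" using rep by (simp add: represents_def)
  have cell: "arr s ''m'' ((int i - 1) * int n + int j) = int (m i j)"
    using rep ij by (simp add: represents_def)
  have e': "aval e s = v" using e[of "arr s"] by (simp add: v_def)
  have "represents n (s\<lparr>arr := A\<rparr>) (set_entry i j w m)"
    unfolding represents_def
  proof (intro conjI allI impI)
    fix a b assume ab: "1 \<le> a \<and> a \<le> n \<and> 1 \<le> b \<and> b \<le> n"
    then show "arr (s\<lparr>arr := A\<rparr>) ''m'' ((int a - 1) * int n + int b) = int (set_entry i j w m a b)"
      using rep cell_inject[of b n j a i] ij
      by (auto simp: A_def set_entry_def represents_def)
  next
    fix a assume a: "1 \<le> a \<and> a \<le> n"
    then have "arr s ''r'' (int a) = int (score n m a)" using rep by (simp add: represents_def)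
    with score_set_entry[OF ij(3,4), of i w m a]
    show "arr (s\<lparr>arr := A\<rparr>) ''r'' (int a) = int (score n (set_entry i j w m) a)"
      by (auto simp: A_def v_def)
  qed (use n in simp)
  from Q[OF this] have "Q (22 + 2 * acost e) (s\<lparr>arr := A\<rparr>)" by (simp add: A_def)
  then show ?thesis
    by (simp add: incr_def x y n cell e' e v_def[symmetric] A_def) (simp add: v_def)
qed

section \<open>The initial tournament\<close>

text \<open>The surplus \<open>E\<close> is spent row by row from row \<open>n\<close> downwards, at most \<open>h\<close> on each pair;
  the truncated subtraction is what is left of \<open>E\<close> when the pair is reached.\<close>

definition initial :: "nat \<Rightarrow> nat \<Rightarrow> nat \<Rightarrow> nat \<Rightarrow> nat \<Rightarrow> nat \<Rightarrow> nat" where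
  "initial n g h E a b =
    (if 1 \<le> b \<and> b < a \<and> a \<le> n
     then g + min h (E - h * ((n choose 2) - (a choose 2) + (b - 1))) else 0)"

text \<open>Conservation of surplus: what the first \<open>q\<close> pairs of the row receive plus
  what is left equals what was available on entering the row. The rows above \<open>a\<close>
  account for \<open>(n choose 2) - (a choose 2)\<close> pairs.\<close>

lemma initial_row:
  assumes "q < a" "a \<le> n"
  shows "(\<Sum>b=1..q. initial n g h E a b) + (E - h * ((n choose 2) - (a choose 2) + q)) =
    g * q + (E - h * ((n choose 2) - (a choose 2)))"
  using assms(1)
proof (induction q)
  case (Suc q)
  define u where "u = (n choose 2) - (a choose 2)"
  have "initial n g h E a (Suc q) = g + min h (E - h * (u + q))"
    using Suc.prems assms by (simp add: initial_def u_def)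
  \<comment> \<open>Truncated subtraction makes \<open>min h x + (x - h) = x\<close> hold in both
    cases.\<close>
  moreover have "min h (E - h * (u + q)) + (E - h * (u + Suc q)) = E - h * (u + q)"
    by (simp add: algebra_simps)
  ultimately show ?case using Suc unfolding u_def[symmetric] by simp
qed simp

lemma score_initial:
  assumes "Suc a \<le> n"
  shows "score n (initial n g h E) (Suc a) + (E - h * ((n choose 2) - (a choose 2))) =
    g * a + (E - h * ((n choose 2) - (Suc a choose 2)))"
proof -
  have "score n (initial n g h E) (Suc a) = (\<Sum>b=1..a. initial n g h E (Suc a) b)"
    unfolding score_def using assms by (intro sum.mono_neutral_right) (auto simp: initial_def)
  moreover have "Suc a choose 2 \<le> n choose 2" by (rule choose2_mono[OF assms])
  then have "(n choose 2) - (Suc a choose 2) + a = (n choose 2) - (a choose 2)"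
    by (simp add: choose2_Suc)
  ultimately show ?thesis using initial_row[of a "Suc a" n g h E] assms by simp
qed

text \<open>The rows telescope: the first \<open>k\<close> rows absorb the surplus that is unspent
  on reaching row \<open>k\<close>. The hypothesis on \<open>E\<close> ensures that nothing is left
  at the end.\<close>

lemma sum_score_initial:
  assumes "k \<le> n" "E \<le> h * (n choose 2)"
  shows "(\<Sum>a=1..k. score n (initial n g h E) a) =
    g * (k choose 2) + (E - h * ((n choose 2) - (k choose 2)))"
  using assms(1)
proof (induction k)
  case (Suc k)
  then show ?case using score_initial[of k n g h E] by (simp add: choose2_Suc algebra_simps)
qed (use assms in \<open>simp add: numeral_2_eq_2\<close>)

lemma tournament_initial: "tournament g (g + h) n (initial n g h E)"
  by (auto simp: tournament_def initial_def)

text \<open>If the truncated remainder is zero, the claim is \<open>lower_ok\<close> at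
  \<open>k\<close>. Otherwise substituting \<open>E\<close> turns the prefix sum into the total
  score minus \<open>(g + h) * ((n choose 2) - (k choose 2))\<close>, and the claim is
  \<open>upper_ok\<close> at \<open>k\<close>.\<close>

lemma sum_score_initial_le:
  assumes low: "lower_ok n d g" and upp: "upper_ok n d (g + h)"
    and E: "(\<Sum>i=1..n. d i) = E + g * (n choose 2)" and k: "k \<le> n"
  shows "(\<Sum>a=1..k. score n (initial n g h E) a) \<le> (\<Sum>i=1..k. d i)"
    "(\<Sum>a=1..n. score n (initial n g h E) a) = (\<Sum>i=1..n. d i)"
proof -
  have c: "k choose 2 \<le> n choose 2" by (rule choose2_mono[OF k])
  \<comment> \<open>\<open>upper_ok\<close> at \<open>k = 0\<close> says that the whole score sum
    fits under \<open>g + h\<close> arcs per pair.\<close>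
  have "E \<le> h * (n choose 2)"
    using upp[unfolded upper_ok_def, rule_format, of 0] E by (simp add: algebra_simps)
  note s = sum_score_initial[OF _ this, of _ g]
  have "g * (k choose 2) \<le> (\<Sum>i=1..k. d i)"
    using low k by (simp add: lower_ok_def)
  moreover have "(\<Sum>i=1..n. d i) + (g + h) * (k choose 2) \<le> (\<Sum>i=1..k. d i) + (g + h) * (n choose 2)"
    using upp k by (simp add: upper_ok_def)
  ultimately show "(\<Sum>a=1..k. score n (initial n g h E) a) \<le> (\<Sum>i=1..k. d i)"
    using s[OF k] E mult_le_mono2[OF c, of h] by (simp add: algebra_simps)
  show "(\<Sum>a=1..n. score n (initial n g h E) a) = (\<Sum>i=1..n. d i)"
    using s[of n] E by simp
qed

section \<open>Writing the initial tournament into memory\<close>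

definition initial_prog :: com where
  "initial_prog =
    ''h'' ::= Sub (Var ''f'') (Var ''g'') ;;
    ''e'' ::= Sub (Var ''S'') (Mul (Var ''g'') (Var ''c'')) ;;
    ''i'' ::= Var ''n'' ;;
    While (Less (Const 0) (Var ''i''))
      (''j'' ::= Const 1 ;;
       While (Less (Var ''j'') (Var ''i''))
         (If (Less (Var ''e'') (Var ''h'')) (''x'' ::= Var ''e'') (''x'' ::= Var ''h'') ;;
          incr ''i'' ''j'' (Add (Var ''g'') (Var ''x'')) ;;
          ''e'' ::= Sub (Var ''e'') (Var ''x'') ;;
          ''j'' ::= Add (Var ''j'') (Const 1)) ;;
       ''i'' ::= Sub (Var ''i'') (Const 1))"

lemma wp_initial_row:
  fixes n g h E i :: nat
  assumes i: "1 \<le> i" "i \<le> n"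
  \<comment> \<open>\<open>M q\<close> is the partly filled matrix: rows above \<open>i\<close> are
    finished, row \<open>i\<close> is filled up to column \<open>q\<close>, and all else is still
    zero.\<close>
  defines "M \<equiv> \<lambda>q a b. if i < a \<or> (a = i \<and> b \<le> q) then initial n g h E a b else 0"
    and "u \<equiv> (n choose 2) - (i choose 2)"
  assumes s: "represents n s (M 0)" "var s ''i'' = int i" "var s ''g'' = int g"
      "var s ''h'' = int h" "var s ''e'' = int (E - h * u)" "var s ''j'' = 1"
      "arr s ''d'' = D"
    and Q: "\<And>t s'. t \<le> 50 * n \<Longrightarrow> represents n s' (M (i - 1)) \<Longrightarrow> var s' ''i'' = int i \<Longrightarrow>
      var s' ''g'' = int g \<Longrightarrow> var s' ''h'' = int h \<Longrightarrow>
      var s' ''e'' = int (E - h * (u + (i - 1))) \<Longrightarrow> arr s' ''d'' = D \<Longrightarrow> Q t s'"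
  shows "wp (While (Less (Var ''j'') (Var ''i''))
         (If (Less (Var ''e'') (Var ''h'')) (''x'' ::= Var ''e'') (''x'' ::= Var ''h'') ;;
          incr ''i'' ''j'' (Add (Var ''g'') (Var ''x'')) ;;
          ''e'' ::= Sub (Var ''e'') (Var ''x'') ;;
          ''j'' ::= Add (Var ''j'') (Const 1))) Q s"
proof (rule wp_While[where N="i - 1" and u="\<lambda>_. 44" and I="\<lambda>q s'. represents n s' (M q) \<and>
    var s' ''i'' = int i \<and> var s' ''g'' = int g \<and> var s' ''h'' = int h \<and>
    var s' ''e'' = int (E - h * (u + q)) \<and> var s' ''j'' = int (q + 1) \<and> arr s' ''d'' = D"], goal_cases)
  case 1
  then show ?case using s by simp
next
  case (2 q s')
  then have q: "q + 1 < i" by simp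
  define e where "e = E - h * (u + q)"
  \<comment> \<open>The cell is still zero, so adding \<open>g + x\<close> to it amounts to writing
    the final entry.\<close>
  have M0: "M q i (q + 1) = 0" by (simp add: M_def)
  have M1: "set_entry i (q + 1) (g + min h e) (M q) = M (Suc q)"
    using q i by (auto simp: fun_eq_iff set_entry_def M_def initial_def e_def u_def)
  have e1: "int e - int (min h e) = int (E - h * (u + Suc q))"
  proof -
    have "E - h * (u + Suc q) = e - h" by (simp add: e_def algebra_simps)
    then show ?thesis by (simp add: min_def of_nat_diff)
  qed
  have inc: "wp (incr ''i'' ''j'' (Add (Var ''g'') (Var ''x''))) R s''"
    if "represents n s'' (M q)" "var s'' ''i'' = int i" "var s'' ''j'' = int (q + 1)"
      "var s'' ''g'' = int g" "var s'' ''x'' = int (min h e)"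
      "\<And>s'. represents n s' (M (Suc q)) \<Longrightarrow> var s' = var s'' \<Longrightarrow>
        arr s' ''d'' = arr s'' ''d'' \<Longrightarrow> R 28 s'" for s'' R
    using wp_incr[OF that(1-3), of "Add (Var ''g'') (Var ''x'')" "g + min h e" R]
      q i that(4-) M0 M1 by simp
  have rep: "represents n (s'\<lparr>var := (var s')(''x'' := v)\<rparr>) (M q)" for v
    using 2 by (simp add: represents_def)
  have rep': "represents n (s''\<lparr>var := V\<rparr>) (M (Suc q))"
    if "represents n s'' (M (Suc q))" "V ''n'' = var s'' ''n''" for s'' V
    using that by (simp add: represents_def)
  show ?case using 2 q e1 by (auto simp: e_def[symmetric] intro!: inc rep rep')
next
  case (3 s')
  then show ?case using i by simp
next
  case (4 t s')
  from 4(2) have "t \<le> 48 * (i - 1) + 4" by simp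
  then have "t \<le> 50 * n" using i by linarith
  then show ?case using 4(3) by (intro Q) auto
qed

lemma represents_cong:
  assumes "represents n s m" "\<And>a b. 1 \<le> a \<Longrightarrow> a \<le> n \<Longrightarrow> 1 \<le> b \<Longrightarrow> b \<le> n \<Longrightarrow> m a b = m' a b"
    "arr s' = arr s" "var s' ''n'' = var s ''n''"
  shows "represents n s' m'"
  using assms by (simp add: represents_def score_def)

lemma wp_initial_prog:
  fixes n g h E :: nat
  assumes s: "represents n s (\<lambda>_ _. 0)" "var s ''g'' = int g" "var s ''f'' = int (g + h)"
      "var s ''S'' = int (E + g * (n choose 2))" "var s ''c'' = int (n choose 2)" "1 \<le> n"
  shows "wp initial_prog (\<lambda>t s'. t \<le> 100 * n ^ 2 \<and> represents n s' (initial n g h E) \<and>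
    arr s' ''d'' = arr s ''d'') s"
proof -
  define M where "M i a b = (if i < a then initial n g h E a b else 0)" for i a b
  have n: "var s ''n'' = int n" using s(1) by (simp add: represents_def)
  show ?thesis
    unfolding initial_prog_def
    apply (simp add: One_nat_def[symmetric] del: One_nat_def)
    apply (rule wp_While[where N=n and u="\<lambda>_. 50 * n + 6" and I="\<lambda>p s'. represents n s' (M (n - p)) \<and>
      var s' ''i'' = int (n - p) \<and> var s' ''g'' = int g \<and> var s' ''h'' = int h \<and>
      var s' ''e'' = int (E - h * ((n choose 2) - (n - p choose 2))) \<and> arr s' ''d'' = arr s ''d''"])
    subgoal
      using s n by (auto simp: M_def initial_def intro!: represents_cong[OF s(1)])
    subgoal for p s'
    proof -
      assume p: "p < n" and I: "represents n s' (M (n - p)) \<and>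
        var s' ''i'' = int (n - p) \<and> var s' ''g'' = int g \<and> var s' ''h'' = int h \<and>
        var s' ''e'' = int (E - h * ((n choose 2) - (n - p choose 2))) \<and> arr s' ''d'' = arr s ''d''"
      define i where "i = n - Suc p"
      have i: "n - p = Suc i" "n - Suc p = i" "Suc i \<le> n" using p by (auto simp: i_def)
      have "Suc i choose 2 \<le> n choose 2" by (rule choose2_mono[OF i(3)])
      then have c: "(n choose 2) - (Suc i choose 2) + i = (n choose 2) - (i choose 2)"
        by (simp add: choose2_Suc)
      show ?thesis
        using I
        apply (simp add: i del: of_nat_Suc)
        apply (rule wp_initial_row[where i="Suc i" and n=n and g=g and h=h and E=E and D="arr s ''d''"])
        subgoal by simp
        subgoal using i by simp
        subgoal by (erule conjE, erule represents_cong) (auto simp: M_def)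
        subgoal by simp
        subgoal by simp
        subgoal by simp
        subgoal by simp
        subgoal by simp
        subgoal by simp
        subgoal for t s''
          using c by (auto simp: M_def initial_def elim!: represents_cong)
        done
    qed
    subgoal by simp
    subgoal for t s'
    proof -
      assume t: "t \<le> (\<Sum>i<n. 50 * n + 6 + 1 + bcost (Less (Const 0) (Var ''i''))) + 1
          + bcost (Less (Const 0) (Var ''i''))"
        and I: "represents n s' (M (n - n)) \<and>
        var s' ''i'' = int (n - n) \<and> var s' ''g'' = int g \<and> var s' ''h'' = int h \<and>
        var s' ''e'' = int (E - h * ((n choose 2) - (n - n choose 2))) \<and> arr s' ''d'' = arr s ''d''"
      have "n * 1 \<le> n * n" "1 * 1 \<le> n * n" using s(6) by (intro mult_le_mono; simp)+
      moreover have "t \<le> 50 * (n * n) + 10 * n + 4" using t by (simp add: algebra_simps)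
      ultimately have "14 + t \<le> 100 * n ^ 2" unfolding power2_eq_square by linarith
      then show ?thesis using I by (auto simp: M_def elim!: represents_cong)
    qed
    done
qed

section \<open>Transferring a point between players\<close>

text \<open>A player \<open>i\<close> whose score exceeds that of \<open>j\<close> does better than \<open>j\<close> against some \<open>k\<close>, possibly
  \<open>j\<close> itself. Moving one point along \<open>i\<close>, \<open>k\<close>, \<open>j\<close> respects the bounds; if \<open>k\<close> has no point
  against \<open>j\<close> to give away, the numbers of arcs on the two pairs leave room to move it directly.\<close>

definition transfer :: "nat \<Rightarrow> nat \<Rightarrow> nat \<Rightarrow> (nat \<Rightarrow> nat \<Rightarrow> nat) \<Rightarrow> nat \<Rightarrow> nat \<Rightarrow> nat" where
  "transfer i j k m =
    (let m1 = set_entry i k (m i k - 1) m in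
     if k = j then set_entry j i (m j i + 1) m1
     else let m2 = set_entry j k (m j k + 1) m1 in
       if m k j = 0 then m2
       else set_entry k i (m k i + 1) (set_entry k j (m k j - 1) m2))"

text \<open>Moving the point along \<open>i\<close>, \<open>k\<close>, \<open>j\<close> preserves
  the number of arcs on each pair. If \<open>m k j = 0\<close>, pair \<open>i\<close>,
  \<open>k\<close> loses an arc and pair \<open>j\<close>, \<open>k\<close> gains one. This is safe
  because \<open>g <= m j k < m i k <= f\<close>: the first pair has more than \<open>g\<close> arcs
  and the second fewer than \<open>f\<close>.\<close>

lemma tournament_transfer:
  assumes t: "tournament g f n m"
    and ij: "1 \<le> i" "i \<le> n" "1 \<le> j" "j \<le> n" "1 \<le> k" "k \<le> n" "i \<noteq> j"
    and less: "m j k < m i k"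
  shows "tournament g f n (transfer i j k m)"
proof -
  have diag: "m a a = 0" if "1 \<le> a" "a \<le> n" for a
    using t that by (simp add: tournament_def)
  have "k \<noteq> i" using less diag[of i] ij by auto
  have pair: "g \<le> m a b + m b a \<and> m a b + m b a \<le> f"
    if "1 \<le> a" "a \<le> n" "1 \<le> b" "b \<le> n" "a \<noteq> b" for a b
    using tournament_pair_le[OF t that] .
  have ik: "g \<le> m i k + m k i" "m i k + m k i \<le> f"
    using pair[of i k] ij \<open>k \<noteq> i\<close> by auto
  have jk: "k \<noteq> j \<Longrightarrow> g \<le> m j k + m k j" "k \<noteq> j \<Longrightarrow> m j k + m k j \<le> f"
    using pair[of j k] ij by auto
  have "g \<le> f" using t by (simp add: tournament_def)
  moreover have "transfer i j k m a a = 0" if "1 \<le> a" "a \<le> n" for a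
    using diag[OF that] \<open>k \<noteq> i\<close> ij by (auto simp: transfer_def set_entry_def Let_def)
  moreover have "g \<le> transfer i j k m a b + transfer i j k m b a \<and>
      transfer i j k m a b + transfer i j k m b a \<le> f"
    if ab: "1 \<le> a" "a \<le> n" "1 \<le> b" "b \<le> n" "a < b" for a b
    using pair[of a b] ab ik jk less \<open>k \<noteq> i\<close> ij
    by (auto simp: transfer_def set_entry_def Let_def split: if_splits)
  ultimately show ?thesis by (auto simp: tournament_def)
qed

text \<open>An intermediate player \<open>k\<close> either is untouched or trades a point against
  \<open>j\<close> for one against \<open>i\<close>, so only the scores of \<open>i\<close> and
  \<open>j\<close> change.\<close>

lemma score_transfer:
  assumes "1 \<le> i" "i \<le> n" "1 \<le> j" "j \<le> n" "1 \<le> k" "k \<le> n" "i \<noteq> j" "k \<noteq> i"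
    and less: "m j k < m i k"
  shows "score n (transfer i j k m) a + (if a = i then 1 else 0) =
    score n m a + (if a = j then 1 else 0)"
proof -
  let ?m1 = "set_entry i k (m i k - 1) m"
  let ?m2 = "set_entry j k (m j k + 1) ?m1"
  let ?m3 = "set_entry k j (m k j - 1) ?m2"
  have 1: "score n ?m1 a + (if a = i then m i k else 0) =
      score n m a + (if a = i then m i k - 1 else 0)"
    using assms by (intro score_set_entry)
  show ?thesis
  proof (cases "k = j")
    case True
    then have "?m1 j i = m j i" using assms by (simp add: set_entry_def)
    with score_set_entry[of i n j "m j i + 1" ?m1 a] 1 less True assms show ?thesis
      by (auto simp: transfer_def split: if_splits)
  next
    case False
    \<comment> \<open>The cells written are pairwise distinct, so each update still finds the
      original entry.\<close>
    then have eq: "?m1 j k = m j k" "?m2 k j = m k j" "?m3 k i = m k i"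
      using assms by (auto simp: set_entry_def)
    have 2: "score n ?m2 a + (if a = j then m j k else 0) =
        score n ?m1 a + (if a = j then m j k + 1 else 0)"
      using score_set_entry[of k n j "m j k + 1" ?m1 a, OF assms(5,6), unfolded eq] .
    have 3: "score n ?m3 a + (if a = k then m k j else 0) =
        score n ?m2 a + (if a = k then m k j - 1 else 0)"
      using score_set_entry[of j n k "m k j - 1" ?m2 a, OF assms(3,4), unfolded eq] .
    have 4: "score n (set_entry k i (m k i + 1) ?m3) a + (if a = k then m k i else 0) =
        score n ?m3 a + (if a = k then m k i + 1 else 0)"
      using score_set_entry[of i n k "m k i + 1" ?m3 a, OF assms(1,2), unfolded eq] .
    have 12: "score n ?m2 a + (if a = i then 1 else 0) = score n m a + (if a = j then 1 else 0)"
      using 1 2 less by (auto split: if_splits)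
    have 34: "score n (set_entry k i (m k i + 1) ?m3) a = score n ?m2 a" if "m k j \<noteq> 0"
      using 3 4 that by (cases "a = k") (simp_all, linarith)
    have "transfer i j k m = (if m k j = 0 then ?m2 else set_entry k i (m k i + 1) ?m3)"
      using False by (simp add: transfer_def Let_def)
    then show ?thesis using 12 34 \<open>i \<noteq> j\<close> by (cases "m k j = 0") simp_all
  qed
qed

section \<open>Repairing the scores\<close>

definition search :: "vname \<Rightarrow> bexp \<Rightarrow> com" where
  "search x b = (x ::= Const 1 ;; While (Neg b) (x ::= Add (Var x) (Const 1)))"

text \<open>The loop tests no upper limit; termination and linear cost rest on the known hit
  \<open>l0\<close>. That the hit found is at most \<open>l0\<close> later places the receiver
  \<open>j\<close> below row \<open>i\<close>.\<close>

lemma wp_search: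
  assumes b: "\<And>l. 1 \<le> l \<Longrightarrow> l \<le> n \<Longrightarrow> bval b (s\<lparr>var := (var s)(x := int l)\<rparr>) \<longleftrightarrow> P l"
    and l: "1 \<le> l0" "l0 \<le> n" "P l0"
    and Q: "\<And>t l. t \<le> (bcost b + 10) * n \<Longrightarrow> 1 \<le> l \<Longrightarrow> l \<le> l0 \<Longrightarrow> P l \<Longrightarrow>
      Q t (s\<lparr>var := (var s)(x := int l)\<rparr>)"
  shows "wp (search x b) Q s"
proof -
  define l where "l = (LEAST l. 1 \<le> l \<and> P l)"
  have l': "1 \<le> l" "P l" "l \<le> l0"
    unfolding l_def using LeastI[of "\<lambda>l. 1 \<le> l \<and> P l" l0] Least_le[of "\<lambda>l. 1 \<le> l \<and> P l" l0] l
    by auto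
  have not: "\<not> P k" if "1 \<le> k" "k < l" for k
    using not_less_Least[of k "\<lambda>l. 1 \<le> l \<and> P l"] that by (auto simp: l_def)
  show ?thesis
    unfolding search_def
    apply (simp add: One_nat_def[symmetric] del: One_nat_def)
    apply (rule wp_While[where N="l - 1" and u="\<lambda>_. 4" and
        I="\<lambda>i s'. s' = s\<lparr>var := (var s)(x := int (i + 1))\<rparr>"])
    subgoal by simp
    subgoal for i s' using b[of "Suc i"] not[of "Suc i"] l' l(2) by (simp add: algebra_simps)
    subgoal using b[of l] l' l(2) by simp
    subgoal for t s'
    proof -
      assume t: "t \<le> (\<Sum>i<l - 1. 4 + 1 + bcost (Neg b)) + 1 + bcost (Neg b)"
        and s': "s' = s\<lparr>var := (var s)(x := int (l - 1 + 1))\<rparr>"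
      have "t \<le> (bcost b + 6) * (l - 1) + bcost b + 2" using t by (simp add: algebra_simps)
      also have "\<dots> \<le> (bcost b + 6) * (l - 1 + 1)" by (simp add: algebra_simps)
      also have "\<dots> \<le> (bcost b + 6) * n" using l' l(2) by (intro mult_le_mono) auto
      finally have "2 + t \<le> (bcost b + 6) * n + 2" by simp
      also have "\<dots> \<le> (bcost b + 10) * n" using l by (simp add: algebra_simps)
      finally show ?thesis using Q[OF _ l'(1,3,2), of "2 + t"] s' l' by simp
    qed
    done
qed

definition transfer_prog :: com where
  "transfer_prog =
    search ''j'' (Less (Arr ''r'' (Var ''j'')) (Arr ''d'' (Var ''j''))) ;;
    search ''k'' (Less (Arr ''m'' (cell ''j'' ''k'')) (Arr ''m'' (cell ''i'' ''k''))) ;;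
    incr ''i'' ''k'' (Const (-1)) ;;
    If (Equal (Var ''k'') (Var ''j''))
      (incr ''j'' ''i'' (Const 1))
      (incr ''j'' ''k'' (Const 1) ;;
       If (Equal (Arr ''m'' (cell ''k'' ''j'')) (Const 0)) Skip
         (incr ''k'' ''j'' (Const (-1)) ;;
          incr ''k'' ''i'' (Const 1)))"

lemma wp_transfer_prog:
  assumes rep: "represents n s m" and t: "tournament g f n m"
    and i: "var s ''i'' = int i" "1 \<le> i" "i \<le> n"
    and d: "\<And>k. 1 \<le> k \<Longrightarrow> k \<le> n \<Longrightarrow> arr s ''d'' (int k) = int (d k)" "mono_on {1..n} d"
    and excess: "d i < score n m i"
    and deficit: "1 \<le> l" "l < i" "score n m l < d l"
  shows "wp transfer_prog (\<lambda>t s'. t \<le> 300 * n \<and> var s' ''i'' = int i \<and>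
    arr s' ''d'' = arr s ''d'' \<and>
    (\<exists>j k. 1 \<le> j \<and> j < i \<and> 1 \<le> k \<and> k \<le> n \<and> k \<noteq> i \<and> m j k < m i k \<and> score n m j < d j \<and>
      represents n s' (transfer i j k m))) s"
proof -
  have n: "var s ''n'' = int n" using rep by (simp add: represents_def)
  have r: "arr s ''r'' (int a) = int (score n m a)" if "1 \<le> a" "a \<le> n" for a
    using rep that by (simp add: represents_def)
  have m: "arr s ''m'' ((int a - 1) * int n + int b) = int (m a b)"
    if "1 \<le> a" "a \<le> n" "1 \<le> b" "b \<le> n" for a b
    using rep that by (simp add: represents_def)
  have diag: "m a a = 0" if "1 \<le> a" "a \<le> n" for a
    using t that by (simp add: tournament_def)
  show ?thesis
    unfolding transfer_prog_def wp_Seq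
  proof (rule wp_search[where n=n and P="\<lambda>j. score n m j < d j" and ?l0.0=l], goal_cases)
    case (1 j)
    then show ?case using r[of j] d(1)[of j] by simp
  next
    case 2
    then show ?case using deficit by simp
  next
    case 3
    then show ?case using deficit i by simp
  next
    case 4
    then show ?case using deficit by simp
  next
    case (5 tj j)
    then have j: "1 \<le> j" "j \<le> n" "j < i" "score n m j < d j" using deficit i by auto
    \<comment> \<open>The point where sortedness of the targets enters: deficit at \<open>j\<close>
      and excess at \<open>i\<close> then force the score of \<open>j\<close> below that of
      \<open>i\<close>.\<close>
    have "d j \<le> d i" using d(2) i j by (auto simp: mono_on_def)
    then have "score n m j < score n m i" using excess j by simp
    \<comment> \<open>A larger row sum exceeds the smaller one in some column, so the second search
      has a hit.\<close>
    then obtain l where l: "1 \<le> l" "l \<le> n" "m j l < m i l"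
      unfolding score_def using sum_mono[of "{1..n}" "m i" "m j"] by (meson atLeastAtMost_iff leD not_le_imp_less)
    show ?case
    proof (rule wp_search[where n=n and P="\<lambda>k. m j k < m i k" and ?l0.0=l], goal_cases)
      case (1 k)
      then show ?case using i j n m[of j k] m[of i k] by simp
    next
      case (5 tk k)
      then have k: "1 \<le> k" "k \<le> n" "m j k < m i k" "k \<noteq> i" using l diag[of i] i by auto
      let ?m1 = "set_entry i k (m i k - 1) m"
      let ?m2 = "set_entry j k (m j k + 1) ?m1"
      let ?m3 = "set_entry k j (m k j - 1) ?m2"
      let ?m4 = "set_entry k i (m k i + 1) ?m3"
      \<comment> \<open>Both searches are linear in \<open>n\<close>; 140 generously covers the
        rest, at most four updates and two tests.\<close>
      have time: "tj + (tk + t) \<le> 300 * n" if "t \<le> 140" for t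
        using 5 \<open>tj \<le> _\<close> that i by simp
      have R: "tj + (tk + t) \<le> 300 * n \<and> var s' ''i'' = int i \<and> arr s' ''d'' = arr s ''d'' \<and>
          (\<exists>j k. 1 \<le> j \<and> j < i \<and> 1 \<le> k \<and> k \<le> n \<and> k \<noteq> i \<and> m j k < m i k \<and> score n m j < d j \<and>
            represents n s' (transfer i j k m))"
        if "t \<le> 140" "var s' ''i'' = int i" "arr s' ''d'' = arr s ''d''"
          "represents n s' (transfer i j k m)" for t s'
        using time that j k by blast
      show ?case
      proof (rule wp_incr[where n=n and m=m and i=i and j=k and w="m i k - 1"], goal_cases)
        case 1
        show ?case using rep by (rule represents_cong) simp_all
      next
        case (9 s1)
        then have s1: "var s1 ''i'' = int i" "var s1 ''j'' = int j" "var s1 ''k'' = int k"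
          "var s1 ''n'' = int n" "arr s1 ''d'' = arr s ''d''"
          using i n by simp_all
        show ?case
        proof (cases "k = j")
          case True
          then have eq: "?m1 j i = m j i" "transfer i j k m = set_entry j i (m j i + 1) ?m1"
            using j by (auto simp: set_entry_def transfer_def)
          have cond: "bval (Equal (Var ''k'') (Var ''j'')) s1" using s1 True by simp
          show ?thesis
            apply (simp only: wp_If cond if_True)
            apply (rule wp_incr[where n=n and m="?m1" and i=j and j=i and w="m j i + 1", OF 9(1)])
            prefer 8 subgoal by (rule R) (use s1 eq in simp_all)
            using s1 i j k eq by auto
        next
          case False
          then have eq: "?m1 j k = m j k" "?m2 k j = m k j" "?m3 k i = m k i"
            "transfer i j k m = (if m k j = 0 then ?m2 else set_entry k i (m k i + 1) ?m3)"
            using j k by (auto simp: set_entry_def transfer_def Let_def)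
          have cond: "\<not> bval (Equal (Var ''k'') (Var ''j'')) s1" using s1 False by simp
          show ?thesis
            apply (simp only: wp_If cond if_False wp_Seq)
          proof (rule wp_incr[where n=n and m="?m1" and i=j and j=k and w="m j k + 1", OF 9(1)], goal_cases)
            case (8 s2)
            then have s2: "var s2 ''i'' = int i" "var s2 ''j'' = int j" "var s2 ''k'' = int k"
              "var s2 ''n'' = int n" "arr s2 ''d'' = arr s ''d''"
              using s1 by simp_all
            \<comment> \<open>The two preceding updates do not touch this cell, so the test sees the
              original \<open>m k j\<close>.\<close>
            have kj: "arr s2 ''m'' ((int k - 1) * int n + int j) = int (m k j)"
              using 8(1) j k unfolding represents_def eq(2)[symmetric] by simp
            show ?case
            proof (cases "m k j = 0")
              case True
              then have cond: "bval (Equal (Arr ''m'' (cell ''k'' ''j'')) (Const 0)) s2"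
                using s2 kj by simp
              show ?thesis
                apply (simp only: wp_If cond if_True wp_Skip)
                apply (rule R)
                using s2 8(1) True eq(4) by simp_all
            next
              case False
              then have cond: "\<not> bval (Equal (Arr ''m'' (cell ''k'' ''j'')) (Const 0)) s2"
                using s2 kj by simp
              show ?thesis
                apply (simp only: wp_If cond if_False wp_Seq)
              proof (rule wp_incr[where n=n and m="?m2" and i=k and j=j and w="m k j - 1", OF 8(1)], goal_cases)
                case (8 s3)
                then have s3: "var s3 ''i'' = int i" "var s3 ''j'' = int j" "var s3 ''k'' = int k"
                  "arr s3 ''d'' = arr s ''d''"
                  using s2 by simp_all
                show ?case
                  apply (rule wp_incr[where n=n and m="?m3" and i=k and j=i and w="m k i + 1", OF 8(1)])
                  prefer 8 subgoal by (rule R) (use s3 eq False in simp_all)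
                  using s3 i j k eq False by auto
              qed (use s2 j k eq False in \<open>auto simp: of_nat_diff\<close>)
            qed
          qed (use s1 j k eq in auto)
        qed
      qed (use i j k in \<open>auto simp: of_nat_diff\<close>)
    qed (use l in auto)
  qed
qed

definition repair_prog :: com where
  "repair_prog =
    ''i'' ::= Const 0 ;;
    While (Less (Var ''i'') (Var ''n''))
      (''i'' ::= Add (Var ''i'') (Const 1) ;;
       While (Less (Arr ''d'' (Var ''i'')) (Arr ''r'' (Var ''i''))) transfer_prog)"

text \<open>Below row \<open>i\<close> no score exceeds its target, and the sum of the first \<open>i\<close> scores is at most
  the sum of the targets, so an excess at \<open>i\<close> comes with a deficit at some smaller index.\<close>

lemma wp_repair_row:
  assumes rep: "represents n s m" and t: "tournament g f n m"
    and i: "var s ''i'' = int i" "1 \<le> i" "i \<le> n"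
    and d: "\<And>k. 1 \<le> k \<Longrightarrow> k \<le> n \<Longrightarrow> arr s ''d'' (int k) = int (d k)" "mono_on {1..n} d"
    and below: "\<And>a. 1 \<le> a \<Longrightarrow> a < i \<Longrightarrow> score n m a \<le> d a"
    and sum: "(\<Sum>a=1..i. score n m a) \<le> (\<Sum>a=1..i. d a)"
  shows "wp (While (Less (Arr ''d'' (Var ''i'')) (Arr ''r'' (Var ''i''))) transfer_prog)
    (\<lambda>t s'. t \<le> (score n m i - d i) * (310 * n) + 6 \<and> var s' ''i'' = int i \<and>
      arr s' ''d'' = arr s ''d'' \<and>
      (\<exists>m'. represents n s' m' \<and> tournament g f n m' \<and>
        (\<forall>a. 1 \<le> a \<and> a \<le> i \<longrightarrow> score n m' a \<le> d a) \<and>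
        (\<forall>a. i < a \<longrightarrow> score n m' a = score n m a) \<and>
        (\<Sum>a=1..i. score n m' a) = (\<Sum>a=1..i. score n m a))) s"
\<comment> \<open>Each transfer lowers the score of \<open>i\<close> by exactly one, so the number
  of iterations is the initial excess; truncated subtraction makes it 0 if there is none.\<close>
proof (rule wp_While[where N="score n m i - d i" and u="\<lambda>_. 300 * n" and
      I="\<lambda>c s'. var s' ''i'' = int i \<and> arr s' ''d'' = arr s ''d'' \<and>
        (\<exists>m'. represents n s' m' \<and> tournament g f n m' \<and>
          (\<forall>a. 1 \<le> a \<and> a < i \<longrightarrow> score n m' a \<le> d a) \<and> score n m' i + c = score n m i \<and>
          (\<forall>a. i < a \<longrightarrow> score n m' a = score n m a) \<and>
          (\<Sum>a=1..i. score n m' a) = (\<Sum>a=1..i. score n m a))"], goal_cases)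
  case 1
  then show ?case using assms by auto
next
  case (2 c s')
  then obtain m' where m': "represents n s' m'" "tournament g f n m'"
    "\<And>a. 1 \<le> a \<Longrightarrow> a < i \<Longrightarrow> score n m' a \<le> d a" "score n m' i + c = score n m i"
    "\<And>a. i < a \<Longrightarrow> score n m' a = score n m a"
    "(\<Sum>a=1..i. score n m' a) = (\<Sum>a=1..i. score n m a)"
    and s': "var s' ''i'' = int i" "arr s' ''d'' = arr s ''d''"
    by blast
  have excess: "d i < score n m' i" using 2(1) m'(4) by linarith
  have "\<exists>l. 1 \<le> l \<and> l < i \<and> score n m' l < d l"
  proof (rule ccontr)
    assume "\<not> ?thesis"
    then have "(\<Sum>a=1..i. d a) < (\<Sum>a=1..i. score n m' a)"
      using excess i(2) by (intro sum_strict_mono_ex1) (auto simp: le_less)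
    then show False using sum m'(6) by simp
  qed
  then obtain l where l: "1 \<le> l" "l < i" "score n m' l < d l" by blast
  have r: "arr s' ''r'' (int i) = int (score n m' i)"
    using m'(1) i by (simp add: represents_def)
  have "wp transfer_prog (\<lambda>t s'. t \<le> 300 * n \<and> var s' ''i'' = int i \<and>
    arr s' ''d'' = arr s ''d'' \<and>
    (\<exists>j k. 1 \<le> j \<and> j < i \<and> 1 \<le> k \<and> k \<le> n \<and> k \<noteq> i \<and> m' j k < m' i k \<and> score n m' j < d j \<and>
      represents n s' (transfer i j k m'))) s'"
    using wp_transfer_prog[OF m'(1,2) s'(1) i(2,3) _ d(2) excess l] d(1) s'(2) by simp
  then show ?case
  proof (intro conjI, goal_cases)
    case 1
    show ?case using s' d(1)[OF i(2,3)] r excess by simp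
  next
    case 2
    then show ?case
    proof (rule wp_mono, elim conjE exE, goal_cases)
      case (1 t' s'' j k)
      let ?m = "transfer i j k m'"
      have tr: "score n ?m a + (if a = i then 1 else 0) = score n m' a + (if a = j then 1 else 0)" for a
        using 1 i by (intro score_transfer) auto
      \<comment> \<open>Donor and receiver both lie in \<open>{1..i}\<close>, so the prefix sum is
        unchanged.\<close>
      have "(\<Sum>a=1..i. score n ?m a) + 1 = (\<Sum>a=1..i. score n ?m a + (if a = i then 1 else 0))"
        using i by (simp add: sum.distrib)
      also have "\<dots> = (\<Sum>a=1..i. score n m' a) + 1"
        unfolding tr using 1 by (simp add: sum.distrib)
      finally have "(\<Sum>a=1..i. score n ?m a) = (\<Sum>a=1..i. score n m a)" using m'(6) by simp
      moreover have "tournament g f n ?m"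
        using 1 i by (intro tournament_transfer m') auto
      \<comment> \<open>Only \<open>j\<close> gains, and its deficit was strict, so no smaller row
        acquires an excess.\<close>
      moreover have "score n ?m a \<le> d a" if "1 \<le> a" "a < i" for a
        using tr[of a] m'(3)[OF that] that 1 by (auto split: if_splits)
      moreover have "score n ?m i + Suc c = score n m i"
        using tr[of i] m'(4) 1 by simp
      moreover have "score n ?m a = score n m a" if "i < a" for a
        using tr[of a] m'(5)[OF that] that 1 by simp
      ultimately show ?case using 1 by blast
    qed
  qed
next
  case (3 s')
  then obtain m' where m': "represents n s' m'" "score n m' i + (score n m i - d i) = score n m i"
    and s': "var s' ''i'' = int i" "arr s' ''d'' = arr s ''d''" by blast
  have "arr s' ''r'' (int i) = int (score n m' i)"
    using m'(1) i by (simp add: represents_def)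
  then show ?case using s' d(1)[OF i(2,3)] m'(2) by simp
next
  case (4 t' s')
  then obtain m' where m': "represents n s' m'" "tournament g f n m'"
    "\<And>a. 1 \<le> a \<Longrightarrow> a < i \<Longrightarrow> score n m' a \<le> d a" "score n m' i + (score n m i - d i) = score n m i"
    "\<And>a. i < a \<Longrightarrow> score n m' a = score n m a"
    "(\<Sum>a=1..i. score n m' a) = (\<Sum>a=1..i. score n m a)"
    and s': "var s' ''i'' = int i" "arr s' ''d'' = arr s ''d''"
    by blast
  have "t' \<le> (score n m i - d i) * (300 * n + 6) + 6" using 4(2) by (simp add: algebra_simps)
  also have "\<dots> \<le> (score n m i - d i) * (310 * n) + 6"
    using i by (intro add_mono mult_le_mono) auto
  finally have "t' \<le> (score n m i - d i) * (310 * n) + 6" .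
  moreover have "score n m' a \<le> d a" if "1 \<le> a" "a \<le> i" for a
    using m'(3)[of a] m'(4) that by (cases "a = i") auto
  ultimately show ?case using m' s' by blast
qed

lemma wp_repair_prog:
  assumes rep: "represents n s m" and t: "tournament g f n m"
    and d: "\<And>k. 1 \<le> k \<Longrightarrow> k \<le> n \<Longrightarrow> arr s ''d'' (int k) = int (d k)" "mono_on {1..n} d"
    and le: "\<And>k. k \<le> n \<Longrightarrow> (\<Sum>a=1..k. score n m a) \<le> (\<Sum>a=1..k. d a)"
    and eq: "(\<Sum>a=1..n. score n m a) = (\<Sum>a=1..n. d a)"
  shows "wp repair_prog (\<lambda>t s'. t \<le> (\<Sum>a=1..n. d a) * (310 * n) + 20 * n + 10 \<and>
    (\<exists>m'. represents n s' m' \<and> tournament g f n m' \<and> has_out_degrees n m' d)) s"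
proof -
  let ?I = "\<lambda>i s'. var s' ''i'' = int i \<and> arr s' ''d'' = arr s ''d'' \<and>
    (\<exists>m'. represents n s' m' \<and> tournament g f n m' \<and>
      (\<forall>a. 1 \<le> a \<and> a \<le> i \<longrightarrow> score n m' a \<le> d a) \<and>
      (\<forall>a. i < a \<longrightarrow> score n m' a = score n m a) \<and>
      (\<Sum>a=1..i. score n m' a) = (\<Sum>a=1..i. score n m a))"
  \<comment> \<open>The cost of a row is measured by its excess in the original \<open>m\<close>:
    the row is untouched until its turn.\<close>
  let ?u = "\<lambda>i. (score n m (Suc i) - d (Suc i)) * (310 * n) + 10"
  show ?thesis
    unfolding repair_prog_def wp_Seq wp_Assign
  proof (rule wp_While[where N=n and u="?u" and I="?I"], goal_cases)
    case 1
    have "represents n (s\<lparr>var := (var s)(''i'' := 0)\<rparr>) m"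
      using rep by (rule represents_cong) simp_all
    then show ?case using t by auto
  next
    case (2 i s')
    then obtain m' where m': "represents n s' m'" "tournament g f n m'"
      "\<And>a. 1 \<le> a \<Longrightarrow> a \<le> i \<Longrightarrow> score n m' a \<le> d a"
      "\<And>a. i < a \<Longrightarrow> score n m' a = score n m a"
      "(\<Sum>a=1..i. score n m' a) = (\<Sum>a=1..i. score n m a)"
      and s': "var s' ''i'' = int i" "arr s' ''d'' = arr s ''d''"
      by blast
    let ?s = "s'\<lparr>var := (var s')(''i'' := int (Suc i))\<rparr>"
    have rep': "represents n ?s m'" using m'(1) by (rule represents_cong) simp_all
    \<comment> \<open>The current prefix sum equals the original one, so the inequality
      \<open>le\<close>, known for \<open>m\<close> only, applies to \<open>m'\<close>.\<close>
    have sum: "(\<Sum>a=1..Suc i. score n m' a) = (\<Sum>a=1..Suc i. score n m a)"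
      using m'(4)[of "Suc i"] m'(5) by simp
    have n: "var s' ''n'' = int n" using m'(1) by (simp add: represents_def)
    have "wp (While (Less (Arr ''d'' (Var ''i'')) (Arr ''r'' (Var ''i''))) transfer_prog)
      (\<lambda>t s''. t \<le> (score n m' (Suc i) - d (Suc i)) * (310 * n) + 6 \<and> var s'' ''i'' = int (Suc i) \<and>
        arr s'' ''d'' = arr ?s ''d'' \<and>
        (\<exists>m''. represents n s'' m'' \<and> tournament g f n m'' \<and>
          (\<forall>a. 1 \<le> a \<and> a \<le> Suc i \<longrightarrow> score n m'' a \<le> d a) \<and>
          (\<forall>a. Suc i < a \<longrightarrow> score n m'' a = score n m' a) \<and>
          (\<Sum>a=1..Suc i. score n m'' a) = (\<Sum>a=1..Suc i. score n m' a))) ?s"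
      using 2 m' s' sum le[of "Suc i"] d by (intro wp_repair_row rep') auto
    then show ?case
      using n s' 2(1) m'(4) unfolding sum
      by (auto simp: algebra_simps simp del: sum.cl_ivl_Suc elim!: wp_mono)
  next
    case (3 s')
    then obtain m' where "represents n s' m'" by blast
    with 3 show ?case by (simp add: represents_def)
  next
    case (4 t s')
    then obtain m' where m': "represents n s' m'" "tournament g f n m'"
      "\<And>a. 1 \<le> a \<Longrightarrow> a \<le> n \<Longrightarrow> score n m' a \<le> d a"
      "(\<Sum>a=1..n. score n m' a) = (\<Sum>a=1..n. score n m a)"
      by blast
    \<comment> \<open>Scores that nowhere exceed their targets and have the same total must equal
      them.\<close>
    have "score n m' a = d a" if "1 \<le> a" "a \<le> n" for a
    proof (rule ccontr)
      assume "score n m' a \<noteq> d a"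
      then have "(\<Sum>a=1..n. score n m' a) < (\<Sum>a=1..n. d a)"
        using m'(3) that by (intro sum_strict_mono_ex1) (auto simp: order.strict_iff_order)
      then show False using m'(4) eq by simp
    qed
    then have "has_out_degrees n m' d" by (simp add: has_out_degrees_def score_def)
    \<comment> \<open>Bounds the total number of transfers by the initial score sum, which equals
      the sum of the targets.\<close>
    moreover have "(\<Sum>i<n. score n m (Suc i) - d (Suc i)) \<le> (\<Sum>i<n. score n m (Suc i))"
      by (intro sum_mono) simp
    then have "(\<Sum>i<n. score n m (Suc i) - d (Suc i)) \<le> (\<Sum>a=1..n. d a)"
      unfolding eq[symmetric] by (simp add: sum.atLeast_Suc_atMost_Suc_shift sum.atLeast1_atMost_eq)
    then have "(\<Sum>i<n. score n m (Suc i) - d (Suc i)) * (310 * n) \<le> (\<Sum>a=1..n. d a) * (310 * n)"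
      by (rule mult_le_mono1)
    then have "t \<le> (\<Sum>a=1..n. d a) * (310 * n) + 14 * n + 4"
      using 4(2) by (simp add: sum.distrib sum_distrib_right)
    ultimately show ?case using m' by (intro conjI exI[of _ m']) auto
  qed
qed

section \<open>Optimality\<close>

lemma optimal_tournamentI:
  assumes "tournament g f n m" "has_out_degrees n m d"
    and "\<And>a. lower_ok n d a \<Longrightarrow> a \<le> g" "\<And>b. upper_ok n d b \<Longrightarrow> f \<le> b"
  shows "optimal_tournament n d g f m"
  unfolding optimal_tournament_def
  using assms tournament_lower_ok tournament_upper_ok by blast

lemma optimal_tournament_unique:
  "optimal_tournament n d g f m \<Longrightarrow> optimal_tournament n d g' f' m' \<Longrightarrow> g = g' \<and> f = f'"
  unfolding optimal_tournament_def by (meson le_antisym)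

text \<open>The score sum lies between \<open>g\<close> and \<open>f\<close> times the number of
  pairs, by the conditions at \<open>k = n\<close> and \<open>k = 0\<close>. This makes
  \<open>h = f - g\<close> an exact difference.\<close>

lemma lower_le_upper:
  assumes "2 \<le> n" "lower_ok n d g" "upper_ok n d f"
  shows "g \<le> f"
proof -
  have "g * (n choose 2) \<le> (\<Sum>i=1..n. d i)" using assms(2) by (simp add: lower_ok_def)
  also have "\<dots> \<le> f * (n choose 2)"
    using assms(3)[unfolded upper_ok_def, rule_format, of 0] by (simp add: numeral_2_eq_2)
  finally show ?thesis using choose2_pos[OF assms(1)] by simp
qed

text \<open>The factor is \<open>max 1 (d n)\<close> because visiting all pairs takes quadratic time
  even when every score is zero. The threshold properties of \<open>g\<close> and \<open>f\<close>
  are exported so that they can be matched with the output of the bounds program alone.\<close>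

lemma construction:
  assumes n: "2 \<le> n" and d: "mono_on {1..n} d"
  obtains t s g f m where
    "exec (bounds_prog ;; initial_prog ;; repair_prog) (input n d) t s"
    "t \<le> 1000 * (max 1 (d n) * n ^ 2)" "optimal_tournament n d g f m" "represents n s m"
    "\<forall>a. lower_ok n d a \<longleftrightarrow> a \<le> g" "\<forall>b. upper_ok n d b \<longleftrightarrow> f \<le> b"
proof -
  have inp: "var (input n d) ''n'' = int n"
      "\<And>k. 1 \<le> k \<Longrightarrow> k \<le> n \<Longrightarrow> arr (input n d) ''d'' (int k) = int (d k)"
    by (simp_all add: input_def)
  from wp_bounds_prog[OF n inp] obtain t1 s1 g f where 1:
    "exec bounds_prog (input n d) t1 s1" "t1 \<le> 100 * n" "arr s1 = arr (input n d)"
    "var s1 ''n'' = int n" "var s1 ''S'' = int (\<Sum>i=1..n. d i)" "var s1 ''c'' = int (n choose 2)"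
    "outputs_bounds s1 g f" "\<forall>a. lower_ok n d a \<longleftrightarrow> a \<le> g" "\<forall>b. upper_ok n d b \<longleftrightarrow> f \<le> b"
    unfolding wp_def by blast
  define h where "h = f - g"
  define E where "E = (\<Sum>i=1..n. d i) - g * (n choose 2)"
  have low: "lower_ok n d g" and upp: "upper_ok n d f" using 1 by auto
  have f: "f = g + h" using lower_le_upper[OF n low upp] by (simp add: h_def)
  have E: "(\<Sum>i=1..n. d i) = E + g * (n choose 2)"
    using low by (simp add: E_def lower_ok_def)
  \<comment> \<open>Memory outside the input is zero, so \<open>m\<close> and \<open>r\<close>
    already hold the zero matrix and its row sums.\<close>
  have rep: "represents n s1 (\<lambda>_ _. 0)"
    using 1 by (simp add: represents_def input_def score_def)
  have "var s1 ''g'' = int g" "var s1 ''f'' = int (g + h)"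
    "var s1 ''S'' = int (E + g * (n choose 2))" "var s1 ''c'' = int (n choose 2)" "1 \<le> n"
    using 1(4-7) n f E by (simp_all add: outputs_bounds_def del: of_nat_sum)
  from wp_initial_prog[OF rep this] obtain t2 s2 where 2:
    "exec initial_prog s1 t2 s2" "t2 \<le> 100 * n ^ 2" "represents n s2 (initial n g h E)"
    "arr s2 ''d'' = arr s1 ''d''"
    unfolding wp_def by blast
  note le = sum_score_initial_le[OF low upp[unfolded f] E]
  have d2: "\<And>k. 1 \<le> k \<Longrightarrow> k \<le> n \<Longrightarrow> arr s2 ''d'' (int k) = int (d k)"
    using 1 2 inp by simp
  from wp_repair_prog[OF 2(3) tournament_initial d2 d le(1) le(2)[OF order_refl]] obtain t3 s3 m where 3:
    "exec repair_prog s2 t3 s3" "t3 \<le> (\<Sum>a=1..n. d a) * (310 * n) + 20 * n + 10"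
    "represents n s3 m" "tournament g (g + h) n m" "has_out_degrees n m d"
    unfolding wp_def by blast
  have "d i \<le> max 1 (d n)" if "i \<in> {1..n}" for i
    using that n mono_onD[OF d, of i n] by simp
  then have "(\<Sum>i=1..n. d i) \<le> (\<Sum>i=1..n. max 1 (d n))" by (intro sum_mono)
  then have "(\<Sum>i=1..n. d i) * (310 * n) \<le> (max 1 (d n) * n) * (310 * n)"
    by (intro mult_le_mono1) (simp add: mult.commute)
  also have "\<dots> = 310 * (max 1 (d n) * n ^ 2)" by (simp add: power2_eq_square)
  finally have t3: "t3 \<le> 310 * (max 1 (d n) * n ^ 2) + 20 * n + 10" using 3(2) by linarith
  have "1 * n ^ 2 \<le> max 1 (d n) * n ^ 2" by (intro mult_le_mono1) simp
  moreover have "1 * n \<le> n * n" "1 * 1 \<le> n * n" using n by (intro mult_le_mono; simp)+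
  ultimately have "t1 + (t2 + t3) \<le> 1000 * (max 1 (d n) * n ^ 2)"
    using t3 2(2) 1(2) unfolding power2_eq_square by linarith
  moreover have "optimal_tournament n d g f m"
    using 3(4,5) f 1(8,9) by (intro optimal_tournamentI) auto
  ultimately show ?thesis
    using that 1(8,9) 3(3) exec.Seq[OF 1(1) exec.Seq[OF 2(1) 3(1)]] by blast
qed

theorem theorem8:
  shows "(\<forall>(n::nat) (d::nat \<Rightarrow> nat). 2 \<le> n \<and> mono_on {1..n} d \<longrightarrow>
            (\<exists>f g m. optimal_tournament n d g f m))
       \<and> (\<exists>(P::com) (c1::real) (c2::real). 0 < c1 \<and>
            (\<forall>(n::nat) (d::nat \<Rightarrow> nat). 2 \<le> n \<and> mono_on {1..n} d \<longrightarrow>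
              (\<exists>t s. exec P (input n d) t s \<and>
                 (\<forall>f g m. optimal_tournament n d g f m \<longrightarrow> outputs_bounds s g f) \<and>
                 c1 * real n \<le> real t \<and> real t \<le> c2 * real n)))
       \<and> (\<exists>(Q::com) (c::real).
            (\<forall>(n::nat) (d::nat \<Rightarrow> nat). 2 \<le> n \<and> mono_on {1..n} d \<longrightarrow>
              (\<exists>t s. exec Q (input n d) t s \<and>
                 (\<exists>f g m. optimal_tournament n d g f m \<and> outputs_matrix s n m) \<and>
                 real t \<le> c * real (max 1 (d n)) * real n ^ 2)))"
proof -
  have "(\<exists>f g m. optimal_tournament n d g f m) \<and>
      (\<exists>t s. exec bounds_prog (input n d) t s \<and>
        (\<forall>f g m. optimal_tournament n d g f m \<longrightarrow> outputs_bounds s g f) \<and>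
        1 * real n \<le> real t \<and> real t \<le> 100 * real n) \<and>
      (\<exists>t s. exec (bounds_prog ;; initial_prog ;; repair_prog) (input n d) t s \<and>
        (\<exists>f g m. optimal_tournament n d g f m \<and> outputs_matrix s n m) \<and>
        real t \<le> 1000 * real (max 1 (d n)) * real n ^ 2)"
    if n: "2 \<le> n" and d: "mono_on {1..n} d" for n and d :: "nat \<Rightarrow> nat"
  proof (intro conjI)
    obtain t s g f m where Q:
      "exec (bounds_prog ;; initial_prog ;; repair_prog) (input n d) t s"
      "t \<le> 1000 * (max 1 (d n) * n ^ 2)" "optimal_tournament n d g f m" "represents n s m"
      "\<forall>a. lower_ok n d a \<longleftrightarrow> a \<le> g" "\<forall>b. upper_ok n d b \<longleftrightarrow> f \<le> b"
      by (rule construction[OF n d])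
    show "\<exists>f g m. optimal_tournament n d g f m" using Q(3) by blast
    have "outputs_matrix s n m"
      using Q(4) by (auto simp: outputs_matrix_def represents_def of_nat_diff)
    moreover have "real t \<le> real (1000 * (max 1 (d n) * n ^ 2))"
      using Q(2) by (rule of_nat_mono)
    then have "real t \<le> 1000 * real (max 1 (d n)) * real n ^ 2" by simp
    ultimately show "\<exists>t s. exec (bounds_prog ;; initial_prog ;; repair_prog) (input n d) t s \<and>
        (\<exists>f g m. optimal_tournament n d g f m \<and> outputs_matrix s n m) \<and>
        real t \<le> 1000 * real (max 1 (d n)) * real n ^ 2"
      using Q by blast
    have "var (input n d) ''n'' = int n" "\<And>k. 1 \<le> k \<Longrightarrow> k \<le> n \<Longrightarrow> arr (input n d) ''d'' (int k) = int (d k)"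
      by (simp_all add: input_def)
    from wp_bounds_prog[OF n this] obtain t' s' g' f' where P:
      "exec bounds_prog (input n d) t' s'" "n \<le> t'" "t' \<le> 100 * n" "outputs_bounds s' g' f'"
      "\<forall>a. lower_ok n d a \<longleftrightarrow> a \<le> g'" "\<forall>b. upper_ok n d b \<longleftrightarrow> f' \<le> b"
      unfolding wp_def by blast
    \<comment> \<open>Thresholds are unique, so the computed bounds are those of the constructed
      optimal tournament; uniqueness of optimal bounds then covers every other optimal one.\<close>
    have "g' = g" "f' = f" using P(5,6) Q(5,6) by (meson le_antisym order_refl)+
    then show "\<exists>t s. exec bounds_prog (input n d) t s \<and>
        (\<forall>f g m. optimal_tournament n d g f m \<longrightarrow> outputs_bounds s g f) \<and>
        1 * real n \<le> real t \<and> real t \<le> 100 * real n"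
      using P(1-4) optimal_tournament_unique[OF Q(3)]
      by (intro exI[of _ t'] exI[of _ s']) auto
  qed
  then show ?thesis
    by (intro conjI, blast)
      (rule exI[of _ bounds_prog], rule exI[of _ 1], rule exI[of _ 100], simp,
       rule exI[of _ "bounds_prog ;; initial_prog ;; repair_prog"], rule exI[of _ 1000], simp)
qed

end
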